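(* For every integer $n \ge 1$, all coins in $[n]$ can be identified in at most $2\lceil \log_2 n \rceil$ weighings; that is, $a(n) \le 2\lceil \log_2 n\rceil$.
   Context: Write $[n]=\{1,2,\ldots,n\}$. There are $n$ coins labelled $1,\ldots,n$. It is known to the audience that the coins weigh $1,2,\ldots,n$ grams in some order, i.e. that there is a permutation $w$ of $[n]$ such that the coin labelled $i$ weighs $w(i)$ grams, but the audience does not know $w$. In truth $w$ is the identity (the coin labelled $i$ weighs $i$ grams), and the person conducting the weighings knows this. A weighing is a pair $(A,B)$ of disjoint subsets of $[n]$ (coins on the left and right pans of a balance scale; the remaining coins are left out). Its outcome for a permutation $w$ is whether $\sum_{i\in A} w(i)$ is less than, equal to, or greater than $\sum_{i\in B} w(i)$. A list of weighings identifies the coin $t\in[n]$ if every permutation $w$ of $[n]$ that gives the same outcome as the identity permutation for every weighing in the list satisfies $w(t)=t$. It identifies all coins if it identifies every $t\in[n]$, i.e. the identity is the only permutation of $[n]$ consistent with the observed outcomes. $a(n)$ denotes the minimum number of weighings in a list that identifies all coins in $[n]$. *)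

theory Defs
  imports Complex_Main "HOL-Combinatorics.Permutations"
begin

type_synonym weighing = "nat set \<times> nat set"

definition is_weighing :: "nat \<Rightarrow> weighing \<Rightarrow> bool" where
  "is_weighing n W \<longleftrightarrow> fst W \<subseteq> {1..n} \<and> snd W \<subseteq> {1..n} \<and> fst W \<inter> snd W = {}"

text \<open>The state of the left pan compared with the right pan.\<close>

datatype outcome = Lighter | Balanced | Heavier

definition weighing_outcome :: "(nat \<Rightarrow> nat) \<Rightarrow> weighing \<Rightarrow> outcome" where
  "weighing_outcome w W =
     (if (\<Sum>i\<in>fst W. w i) < (\<Sum>i\<in>snd W. w i) then Lighter
      else if (\<Sum>i\<in>fst W. w i) = (\<Sum>i\<in>snd W. w i) then Balanced
      else Heavier)"

definition identifies :: "nat \<Rightarrow> weighing list \<Rightarrow> nat \<Rightarrow> bool" where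
  "identifies n Ws t \<longleftrightarrow>
     (\<forall>w. w permutes {1..n} \<and>
          (\<forall>W\<in>set Ws. weighing_outcome w W = weighing_outcome id W) \<longrightarrow> w t = t)"

definition identifies_all :: "nat \<Rightarrow> weighing list \<Rightarrow> bool" where
  "identifies_all n Ws \<longleftrightarrow> (\<forall>t\<in>{1..n}. identifies n Ws t)"

text \<open>The function \<open>a(n)\<close>; \<open>LEAST\<close> is meaningful only if some list of weighings
  identifies all coins.\<close>

definition min_weighings :: "nat \<Rightarrow> nat" where
  "min_weighings n =
     (LEAST k. \<exists>Ws. length Ws = k \<and> (\<forall>W\<in>set Ws. is_weighing n W) \<and> identifies_all n Ws)"

end

theory Submission
  imports Defs
begin

text \<open>
  A weighing is a vector \<open>W\<close> with entries in \<open>{-1, 0, 1}\<close>, and its outcome is the sign of \<open>\<Sum> W i * w i\<close>. If the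
  signed sum at the true weights is 0 or \<open>-1\<close>, then the outcome implies that the unknown permutation \<open>w\<close>
  satisfies \<open>\<Sum> W i * w i \<le> \<Sum> W i * i\<close>. Adding such inequalities with nonnegative multipliers gives
  \<open>\<Sum> c i * w i \<le> \<Sum> c i * i\<close> for the combination \<open>c\<close> of the vectors. If \<open>c\<close> is strictly decreasing, the rearrangement
  inequality leaves only the identity. So it is enough to write a strictly decreasing vector \<open>c\<close> as a
  combination of few weighings of this kind (\<open>certifiable_decreasing_identifies\<close>).

  Let \<open>m = \<lceil>log 2 n\<rceil>\<close>. The vector \<open>c\<close> is a rounding of half of the linear function \<open>2 n + 1 - 3 i\<close>, which is
  balanced, that is, orthogonal to the vector of weights. A balanced rounding of this function divided by \<open>2 ^ j\<close>
  is constructed for \<open>j = m + 1, \<dots>, 1\<close>, where a rounding may go to the integer part or to the next integer. For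
  \<open>j = m + 1\<close> the zero vector serves. For the step, the previous rounding \<open>c\<close> is replaced by the sum \<open>d + e\<close> of
  two balanced roundings of the same function as \<open>c\<close>, chosen such that \<open>d + e\<close> rounds the function of the next level;
  then \<open>d + e = 2 c + (d - c) + (e - c)\<close>, and the two differences are balanced weighings
  (\<open>certifiable_refine\<close>). This is repeated \<open>m\<close> times and costs \<open>2 m\<close> weighings.

  The existence of \<open>d\<close> and \<open>e\<close> is a question about subset sums. The sets of coins that are rounded up in \<open>d\<close> and
  in \<open>e\<close> must have prescribed sums, and each coin restricts only how often it is rounded up. The coins are cut
  into two halves such that \<open>d\<close> is free on one half and \<open>e\<close> on the other (\<open>halving_sets\<close>), and both halves are
  dense enough for their subset sums to fill long intervals. That the required sums lie in these intervals
  follows from the equidistribution of the linear function modulo powers of 2 (\<open>rounding_slack_fine\<close>,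
  \<open>rounding_slack_coarse\<close>). The last step, where the result has to be strictly decreasing, needs a variant that touches
  mainly the even coins (\<open>finest_rounding\<close>). The estimates are used from 32 coins on; for 3 to 31 coins a table provides
  four weighings.
\<close>

section \<open>Linear certificates for the identity permutation\<close>

text \<open>A vector of moment 0 is called balanced: as a weighing it keeps the scale in equilibrium at the true
  weights.\<close>

definition moment :: "nat \<Rightarrow> (nat \<Rightarrow> int) \<Rightarrow> int" where
  "moment n f = (\<Sum>i\<in>{1..n}. f i * int i)"

definition signed_weighing :: "nat \<Rightarrow> (nat \<Rightarrow> int) \<Rightarrow> weighing" where
  "signed_weighing n f = ({i\<in>{1..n}. f i = 1}, {i\<in>{1..n}. f i = -1})"

text \<open>Bounds of this form can be added and scaled, so the information of several weighings can be combined
  linearly.\<close>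

definition bounds_moment :: "nat \<Rightarrow> weighing list \<Rightarrow> (nat \<Rightarrow> int) \<Rightarrow> bool" where
  "bounds_moment n Ws c \<longleftrightarrow>
     (\<forall>w. w permutes {1..n} \<and> (\<forall>W\<in>set Ws. weighing_outcome w W = weighing_outcome id W) \<longrightarrow>
          (\<Sum>i\<in>{1..n}. c i * int (w i)) \<le> moment n c)"

lemma monotone_permutation_fixes:
  assumes p: "u permutes {1..n::nat}"
    and mono: "\<And>i j. i \<in> {1..n} \<Longrightarrow> j \<in> {1..n} \<Longrightarrow> i < j \<Longrightarrow> u i \<le> u j"
    and "i \<in> {1..n}"
  shows "u i = i"
  using \<open>i \<in> {1..n}\<close>
proof (induction i rule: less_induct)
  case (less i)
  have inj: "u a = u b \<longleftrightarrow> a = b" for a b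
    using permutes_inj[OF p] by (auto simp: inj_def)
  obtain k where k: "k \<in> {1..n}" "u k = i"
    using permutes_image[OF p] less.prems by (metis imageE)
  show ?case
  proof (rule ccontr)
    assume ne: "u i \<noteq> i"
    then have "k \<noteq> i" using k by auto
    moreover have "\<not> k < i" using less.IH[of k] k by auto
    ultimately have "i < k" by simp
    then have "u i \<le> i" using mono[of i k] k less.prems by simp
    then have "u i < i" using ne by simp
    moreover have "u i \<in> {1..n}" using permutes_in_image[OF p] less.prems by simp
    ultimately have "u (u i) = u i" using less.IH by blast
    then show False using inj ne by simp
  qed
qed

text \<open>For strictly decreasing \<open>c\<close> the identity is the only minimiser of
  \<open>\<Sum> c i * w i\<close> over permutations: exchanging two values that form an inversion lowers the
  sum, so a minimiser has no inversion.\<close>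

lemma rearrangement_identity:
  fixes c :: "nat \<Rightarrow> int"
  assumes p: "w permutes {1..n}"
    and dec: "\<And>i j. i \<in> {1..n} \<Longrightarrow> j \<in> {1..n} \<Longrightarrow> i < j \<Longrightarrow> c j < c i"
    and le: "(\<Sum>i\<in>{1..n}. c i * int (w i)) \<le> moment n c"
    and t: "t \<in> {1..n}"
  shows "w t = t"
proof -
  define g where "g v = (\<Sum>i\<in>{1..n}. c i * int (v i))" for v :: "nat \<Rightarrow> nat"
  have fixes_minimiser: "u x = x"
    if u: "u permutes {1..n}" and min: "\<And>v. v permutes {1..n} \<Longrightarrow> g u \<le> g v" and x: "x \<in> {1..n}"
    for u x
  proof (rule monotone_permutation_fixes[OF u _ x])
    fix i j assume ij: "i \<in> {1..n}" "j \<in> {1..n}" "i < j"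
    show "u i \<le> u j"
    proof (rule ccontr)
      assume "\<not> u i \<le> u j"
      then have lt: "u j < u i" by simp
      \<comment> \<open>Undo the inversion.\<close>
      define v where "v = u \<circ> transpose i j"
      have v: "v permutes {1..n}"
        unfolding v_def using ij u by (intro permutes_compose permutes_swap_id) auto
      have split: "(\<Sum>k\<in>{1..n}. f k) = f i + f j + (\<Sum>k\<in>{1..n} - {i, j}. f k)" for f :: "nat \<Rightarrow> int"
      proof -
        have "(\<Sum>k\<in>{1..n}. f k) = (\<Sum>k\<in>{1..n} - {i, j}. f k) + sum f {i, j}"
          using ij by (intro sum.subset_diff) auto
        then show ?thesis using ij by simp
      qed
      have rest: "(\<Sum>k\<in>{1..n} - {i, j}. c k * int (v k)) = (\<Sum>k\<in>{1..n} - {i, j}. c k * int (u k))"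
        by (rule sum.cong) (auto simp: v_def transpose_def)
      have "g u - g v = (c i - c j) * (int (u i) - int (u j))"
        unfolding g_def split rest using ij by (simp add: v_def algebra_simps)
      moreover have "(c i - c j) * (int (u i) - int (u j)) > 0"
        using dec[OF ij] lt by simp
      ultimately show False using min[OF v] by simp
    qed
  qed
  have "finite {v. v permutes {1..n}}" by (simp add: finite_permutations)
  moreover have "{v. v permutes {1..n}} \<noteq> {}" using p by auto
  ultimately obtain u where u: "u permutes {1..n}" "\<And>v. v permutes {1..n} \<Longrightarrow> g u \<le> g v"
    using ex_min_if_finite[of "g ` {v. v permutes {1..n}}"]
    by (auto simp: not_less)
  have "g u = moment n c"
    unfolding g_def moment_def using fixes_minimiser[OF u] by (intro sum.cong) auto
  then have "g w \<le> g v" if "v permutes {1..n}" for v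
    using le u(2)[OF that] unfolding g_def by linarith
  then show ?thesis using fixes_minimiser[OF p _ t] by blast
qed

lemma decreasing_bound_identifies:
  assumes "bounds_moment n Ws c"
    and "\<And>i j. i \<in> {1..n} \<Longrightarrow> j \<in> {1..n} \<Longrightarrow> i < j \<Longrightarrow> c j < c i"
  shows "identifies_all n Ws"
  using assms rearrangement_identity
  unfolding identifies_all_def identifies_def bounds_moment_def by blast

lemma is_weighing_signed_weighing: "is_weighing n (signed_weighing n f)"
  by (auto simp: is_weighing_def signed_weighing_def)

lemma signed_weighing_difference:
  assumes "\<And>i. i \<in> {1..n} \<Longrightarrow> f i \<in> {-1, 0, 1}"
  shows "(\<Sum>i\<in>{1..n}. f i * int (w i)) =
         int (\<Sum>i\<in>fst (signed_weighing n f). w i) - int (\<Sum>i\<in>snd (signed_weighing n f). w i)"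
proof -
  have "(\<Sum>i\<in>{1..n}. f i * int (w i)) =
    (\<Sum>i\<in>{1..n}. (if f i = 1 then int (w i) else 0) - (if f i = -1 then int (w i) else 0))"
    using assms by (intro sum.cong) auto
  also have "\<dots> = (\<Sum>i\<in>{1..n}. if f i = 1 then int (w i) else 0) - (\<Sum>i\<in>{1..n}. if f i = -1 then int (w i) else 0)"
    by (rule sum_subtractf)
  also have "(\<Sum>i\<in>{1..n}. if f i = 1 then int (w i) else 0) = (\<Sum>i\<in>fst (signed_weighing n f). int (w i))"
    unfolding signed_weighing_def fst_conv by (rule sum.inter_filter[symmetric]) simp
  also have "(\<Sum>i\<in>{1..n}. if f i = -1 then int (w i) else 0) = (\<Sum>i\<in>snd (signed_weighing n f). int (w i))"
    unfolding signed_weighing_def snd_conv by (rule sum.inter_filter[symmetric]) simp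
  finally show ?thesis by simp
qed

text \<open>If the signed sum at the true weights is 0, the outcome shows that it is 0 for \<open>w\<close> as
  well. If it is \<open>-1\<close>, the outcome shows a negative sum, which by integrality is at most
  \<open>-1\<close>. So in both cases the true value is an upper bound; a true value below \<open>-1\<close>
  would leave a gap.\<close>

lemma bounds_moment_Cons:
  assumes c: "bounds_moment n Ws c"
    and f: "\<And>i. i \<in> {1..n} \<Longrightarrow> f i \<in> {-1, 0, 1}" "moment n f \<in> {-1, 0}"
    and ab: "a \<ge> 0" "b \<ge> 0"
  shows "bounds_moment n (signed_weighing n f # Ws) (\<lambda>i. a * c i + b * f i)"
  unfolding bounds_moment_def
proof (intro allI impI, elim conjE)
  fix w assume w: "w permutes {1..n}"
    and same: "\<forall>W\<in>set (signed_weighing n f # Ws). weighing_outcome w W = weighing_outcome id W"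
  have le_c: "(\<Sum>i\<in>{1..n}. c i * int (w i)) \<le> moment n c"
    using c w same by (simp add: bounds_moment_def)
  let ?L = "\<lambda>w :: nat \<Rightarrow> nat. (\<Sum>i\<in>fst (signed_weighing n f). w i)"
    and ?R = "\<lambda>w :: nat \<Rightarrow> nat. (\<Sum>i\<in>snd (signed_weighing n f). w i)"
  have m: "moment n f = int (?L id) - int (?R id)"
    using signed_weighing_difference[OF f(1), where w = id] by (simp add: moment_def)
  have o: "weighing_outcome w (signed_weighing n f) = weighing_outcome id (signed_weighing n f)"
    using same by simp
  have "int (?L w) - int (?R w) \<le> moment n f"
  proof (cases "moment n f = 0")
    case True
    then have "?L id = ?R id" using m by (simp del: of_nat_sum)
    then have "?L w = ?R w" using o by (auto simp: weighing_outcome_def split: if_splits)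
    then show ?thesis using True by simp
  next
    case False
    then have "int (?L id) < int (?R id)" using m f(2) by (auto simp del: of_nat_sum)
    then have "?L id < ?R id" by (simp only: of_nat_less_iff)
    then have "?L w < ?R w" using o by (auto simp: weighing_outcome_def split: if_splits)
    then have "int (?L w) < int (?R w)" by (simp only: of_nat_less_iff)
    then show ?thesis using f(2) False by (auto simp del: of_nat_sum)
  qed
  then have le_f: "(\<Sum>i\<in>{1..n}. f i * int (w i)) \<le> moment n f"
    using signed_weighing_difference[OF f(1), where w = w] by simp
  have "(\<Sum>i\<in>{1..n}. (a * c i + b * f i) * int (w i)) =
        a * (\<Sum>i\<in>{1..n}. c i * int (w i)) + b * (\<Sum>i\<in>{1..n}. f i * int (w i))"
    by (simp add: sum.distrib sum_distrib_left algebra_simps)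
  also have "\<dots> \<le> a * moment n c + b * moment n f"
    using le_c le_f ab by (intro add_mono mult_left_mono)
  also have "\<dots> = moment n (\<lambda>i. a * c i + b * f i)"
    by (simp add: moment_def sum.distrib sum_distrib_left algebra_simps)
  finally show "(\<Sum>i\<in>{1..n}. (a * c i + b * f i) * int (w i)) \<le> moment n (\<lambda>i. a * c i + b * f i)" .
qed

definition certifiable :: "nat \<Rightarrow> nat \<Rightarrow> (nat \<Rightarrow> int) \<Rightarrow> bool" where
  "certifiable n k c \<longleftrightarrow>
     (\<exists>Ws. length Ws = k \<and> (\<forall>W\<in>set Ws. is_weighing n W) \<and> bounds_moment n Ws c)"

lemma certifiable_zero: "certifiable n 0 (\<lambda>_. 0)"
  by (auto simp: certifiable_def bounds_moment_def moment_def)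

lemma certifiable_Suc:
  assumes "certifiable n k c" and "\<And>i. i \<in> {1..n} \<Longrightarrow> f i \<in> {-1, 0, 1}" "moment n f \<in> {-1, 0}" "a \<ge> 0" "b \<ge> 0"
  shows "certifiable n (Suc k) (\<lambda>i. a * c i + b * f i)"
proof -
  obtain Ws where "length Ws = k" "\<forall>W\<in>set Ws. is_weighing n W" "bounds_moment n Ws c"
    using assms(1) by (auto simp: certifiable_def)
  then show ?thesis
    unfolding certifiable_def using bounds_moment_Cons[OF _ assms(2-5), of Ws c] is_weighing_signed_weighing
    by (intro exI[of _ "signed_weighing n f # Ws"]) auto
qed

lemma moment_diff: "moment n (\<lambda>i. f i - g i) = moment n f - moment n g"
  by (simp add: moment_def left_diff_distrib sum_subtractf)

lemma moment_add: "moment n (\<lambda>i. f i + g i) = moment n f + moment n g"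
  by (simp add: moment_def distrib_right sum.distrib)

text \<open>The three vectors \<open>c\<close>, \<open>d\<close>, \<open>e\<close> round the same quantity to
  one of the same two neighbouring integers, so \<open>d - c\<close> and \<open>e - c\<close> have entries in
  \<open>{-1, 0, 1}\<close> and are weighings. Since \<open>d + e = 2 c + (d - c) + (e - c)\<close>, two
  weighings double the resolution of \<open>c\<close>.\<close>

lemma certifiable_refine:
  assumes c: "certifiable n k c" "moment n c = 0" "\<And>i. i \<in> {1..n} \<Longrightarrow> c i \<in> {q i, q i + 1}"
    and d: "moment n d = 0" "\<And>i. i \<in> {1..n} \<Longrightarrow> d i \<in> {q i, q i + 1}"
    and e: "moment n e = 0" "\<And>i. i \<in> {1..n} \<Longrightarrow> e i \<in> {q i, q i + 1}"
  shows "certifiable n (Suc (Suc k)) (\<lambda>i. d i + e i)"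
proof -
  have "certifiable n (Suc k) (\<lambda>i. 2 * c i + 1 * (d i - c i))"
    by (rule certifiable_Suc[OF c(1)]) (use c(2,3) d in \<open>fastforce simp: moment_diff\<close>)+
  then have "certifiable n (Suc (Suc k)) (\<lambda>i. 1 * (2 * c i + 1 * (d i - c i)) + 1 * (e i - c i))"
    by (rule certifiable_Suc) (use c(2,3) e in \<open>fastforce simp: moment_diff\<close>)+
  moreover have "(\<lambda>i. 1 * (2 * c i + 1 * (d i - c i)) + 1 * (e i - c i)) = (\<lambda>i. d i + e i)" by auto
  ultimately show ?thesis by (simp only:)
qed

lemma certifiable_decreasing_identifies:
  assumes c: "certifiable n k c" and dec: "\<And>i. 1 \<le> i \<Longrightarrow> i < n \<Longrightarrow> c (Suc i) < c i"
  shows "\<exists>Ws. length Ws = k \<and> (\<forall>W\<in>set Ws. is_weighing n W) \<and> identifies_all n Ws"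
proof -
  have "c j < c i" if "1 \<le> i" "i < j" "j \<le> n" for i j
    using that(2,3)
  proof (induction j)
    case (Suc j)
    then show ?case using dec[of j] that(1) by (cases "i = j") auto
  qed simp
  then show ?thesis
    using c decreasing_bound_identifies unfolding certifiable_def by (metis atLeastAtMost_iff)
qed

section \<open>Splitting a set of coins into two parts with flexible subset sums\<close>

text \<open>If the subset sums of an initial part of \<open>F\<close> fill an interval with at least as many
  integers as the value of the next element, adding that element extends the interval without a gap. The
  condition that \<open>F\<close> meets every window of three consecutive numbers makes the interval grow faster
  than the elements. The loss \<open>l\<close> at both ends stays fixed.\<close>

lemma subset_sums_fill_interval:
  fixes F :: "nat set" and l :: int
  defines "S \<equiv> \<lambda>k. \<Sum>i\<in>F \<inter> {1..k}. int i"
  assumes base: "\<And>t. l \<le> t \<Longrightarrow> t \<le> S 8 - l \<Longrightarrow> \<exists>X\<subseteq>F \<inter> {1..8}. (\<Sum>i\<in>X. int i) = t"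
    and size: "S 8 \<ge> 2 * l + 10"
    and dense: "\<And>i. 9 \<le> i \<Longrightarrow> i + 2 \<le> n \<Longrightarrow> F \<inter> {i..i + 2} \<noteq> {}"
    and "8 \<le> k" "k \<le> n" "l \<le> t" "t \<le> S k - l"
  shows "\<exists>X\<subseteq>F \<inter> {1..k}. (\<Sum>i\<in>X. int i) = t"
proof -
  have S_Suc: "S (Suc k) = S k + (if Suc k \<in> F then int (Suc k) else 0)" for k
  proof -
    have "F \<inter> {1..Suc k} = (if Suc k \<in> F then insert (Suc k) (F \<inter> {1..k}) else F \<inter> {1..k})"
      by (auto simp: le_Suc_eq)
    then show ?thesis by (simp add: S_def)
  qed
  have S_mono: "S j \<le> S k" if "j \<le> k" for j k
    unfolding S_def using that by (intro sum_mono2) auto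
  have grow: "S k \<ge> 2 * l + int k" if "8 \<le> k" "k \<le> n" for k
    using that
  proof (induction k rule: less_induct)
    case (less k)
    show ?case
    proof (cases "k \<le> 10")
      case True
      then show ?thesis using S_mono[of 8 k] less.prems size by linarith
    next
      case False
      then have "k - 2 + 2 = k" by simp
      then have "F \<inter> {k - 2..k} \<noteq> {}"
        using dense[of "k - 2"] less.prems False by simp
      then obtain e where e: "e \<in> F" "k - 2 \<le> e" "e \<le> k" by auto
      then have "e \<ge> 1" using False by linarith
      then have "S e = S (e - 1) + int e" using S_Suc[of "e - 1"] e by simp
      moreover have "S (k - 3) \<le> S (e - 1)" using e by (intro S_mono) linarith
      moreover have "S e \<le> S k" using e by (intro S_mono)
      moreover have "S (k - 3) \<ge> 2 * l + int (k - 3)" using less.IH[of "k - 3"] less.prems False by auto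
      ultimately show ?thesis using e False by linarith
    qed
  qed
  show ?thesis
    using \<open>8 \<le> k\<close> \<open>k \<le> n\<close> \<open>l \<le> t\<close> \<open>t \<le> S k - l\<close>
  proof (induction k arbitrary: t rule: dec_induct)
    case base
    then show ?case using assms(2) by simp
  next
    case (step k)
    show ?case
    proof (cases "t \<le> S k - l")
      case True
      then obtain X where "X \<subseteq> F \<inter> {1..k}" "(\<Sum>i\<in>X. int i) = t" using step by force
      then show ?thesis by (intro exI[of _ X]) auto
    next
      case False
      then have mem: "Suc k \<in> F" and t: "t \<le> S k + int (Suc k) - l"
        using step.prems S_Suc[of k] by (auto split: if_splits)
      have "l \<le> t - int (Suc k)" using False grow[of k] step by linarith
      then have "\<exists>X\<subseteq>F \<inter> {1..k}. (\<Sum>i\<in>X. int i) = t - int (Suc k)"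
        using step.prems t by (intro step.IH) linarith+
      then obtain X where X: "X \<subseteq> F \<inter> {1..k}" "(\<Sum>i\<in>X. int i) = t - int (Suc k)" by blast
      have "Suc k \<notin> X" "finite X" using X finite_subset by auto
      then show ?thesis using X mem by (intro exI[of _ "insert (Suc k) X"]) auto
    qed
  qed
qed

text \<open>Dealing out the elements of a set in increasing order to two players, this is the share of the first
  one. Both shares have nearly the same sum, and neighbouring elements go to different players.\<close>

definition alternate :: "nat set \<Rightarrow> nat set" where
  "alternate S = {i\<in>S. even (card {j\<in>S. j < i})}"

lemma alternate_subset: "alternate S \<subseteq> S"
  by (auto simp: alternate_def)

lemma alternate_sum_diff:
  assumes "S \<subseteq> {..n}"
  shows "\<bar>(\<Sum>i\<in>alternate S. int i) - (\<Sum>i\<in>S - alternate S. int i)\<bar> \<le> int n"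
proof -
  define f where "f k = (\<Sum>i\<in>alternate S \<inter> {..<k}. int i) - (\<Sum>i\<in>(S - alternate S) \<inter> {..<k}. int i)" for k
  have cut: "T \<inter> {..<Suc k} = (if k \<in> T then insert k (T \<inter> {..<k}) else T \<inter> {..<k})" for T :: "nat set" and k
    by (auto simp: less_Suc_eq)
  have f_Suc: "f (Suc k) = f k + (if k \<in> alternate S then int k else 0) - (if k \<in> S - alternate S then int k else 0)" for k
    unfolding f_def cut by simp
  have card_Suc: "card {j\<in>S. j < Suc k} = card {j\<in>S. j < k} + (if k \<in> S then 1 else 0)" for k
  proof -
    have "{j\<in>S. j < Suc k} = (if k \<in> S then insert k {j\<in>S. j < k} else {j\<in>S. j < k})"
      by (auto simp: less_Suc_eq)
    then show ?thesis by simp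
  qed
  have "(even (card {j\<in>S. j < k}) \<longrightarrow> - int (k - 1) \<le> f k \<and> f k \<le> 0) \<and>
        (odd (card {j\<in>S. j < k}) \<longrightarrow> 0 \<le> f k \<and> f k \<le> int (k - 1))" for k
  proof (induction k)
    case 0
    then show ?case by (simp add: f_def)
  next
    case (Suc k)
    have "k \<in> alternate S \<longleftrightarrow> k \<in> S \<and> even (card {j\<in>S. j < k})" by (simp add: alternate_def)
    then show ?case using Suc f_Suc[of k] card_Suc[of k] by auto
  qed
  from this[of "Suc n"] have "\<bar>f (Suc n)\<bar> \<le> int n" by (cases "even (card {j\<in>S. j < Suc n})") auto
  moreover have "alternate S \<inter> {..<Suc n} = alternate S" "(S - alternate S) \<inter> {..<Suc n} = S - alternate S"
    using assms by (auto simp: alternate_def)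
  ultimately show ?thesis by (simp add: f_def)
qed

lemma alternate_neighbours:
  assumes "i \<in> S" "j \<in> S" "i < j" "\<And>k. i < k \<Longrightarrow> k < j \<Longrightarrow> k \<notin> S"
  shows "i \<in> alternate S \<longleftrightarrow> j \<notin> alternate S"
proof -
  have "k < j \<longleftrightarrow> k = i \<or> k < i" if "k \<in> S" for k
    using assms that by (cases k i rule: linorder_cases) auto
  then have "{k\<in>S. k < j} = insert i {k\<in>S. k < i}" using assms(1) by blast
  then show ?thesis using assms by (simp add: alternate_def)
qed

text \<open>Among three consecutive numbers that are coloured with two colours, two have the same colour and no
  number of that colour between them. If each colour class is dealt out alternately, these two go to different
  players.\<close>

lemma alternate_window:
  assumes S: "S \<inter> T = {}" "{i, i + 1, i + 2} \<subseteq> S \<union> T"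
  defines "F \<equiv> alternate S \<union> alternate T"
  shows "F \<inter> {i..i + 2} \<noteq> {}" "((S \<union> T) - F) \<inter> {i..i + 2} \<noteq> {}"
proof -
  have pair: "\<exists>x\<in>{i..i+2}. \<exists>y\<in>{i..i+2}. x \<in> F \<and> y \<in> (S \<union> T) - F"
    if "j \<in> P" "k \<in> P" "j < k" "\<And>x. j < x \<Longrightarrow> x < k \<Longrightarrow> x \<notin> P" "P = S \<or> P = T"
      "i \<le> j" "k \<le> i + 2" for j k P
  proof -
    have "x \<in> F \<longleftrightarrow> x \<in> alternate P" if "x \<in> P" for x
      using \<open>P = S \<or> P = T\<close> that alternate_subset[of S] alternate_subset[of T] S(1) unfolding F_def by auto
    then have "j \<in> F \<longleftrightarrow> k \<notin> F" using alternate_neighbours[OF that(1-4)] that(1,2) by simp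
    moreover have "j \<in> {i..i+2}" "k \<in> {i..i+2}" "j \<in> S \<union> T" "k \<in> S \<union> T" using that by auto
    ultimately show ?thesis by blast
  qed
  let ?side = "\<lambda>x. if x \<in> S then S else T"
  have side: "x \<in> ?side x" if "x \<in> {i, i + 1, i + 2}" for x using S(2) that by auto
  have "\<exists>j\<in>{i..i+2}. \<exists>k\<in>{i..i+2}. j \<in> F \<and> k \<in> (S \<union> T) - F"
  proof (cases "?side i = ?side (i + 1)")
    case True
    then have "i + 1 \<in> ?side i" using side[of "i + 1"] by simp
    with side[of i] show ?thesis by (intro pair[of i "?side i" "i + 1"]) auto
  next
    case differ: False
    show ?thesis
    proof (cases "?side (i + 1) = ?side (i + 2)")
      case True
      then have "i + 2 \<in> ?side (i + 1)" using side[of "i + 2"] by simp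
      with side[of "i + 1"] show ?thesis by (intro pair[of "i + 1" "?side (i + 1)" "i + 2"]) auto
    next
      case False
      then have "?side (i + 2) = ?side i" using differ by (auto split: if_splits)
      then have "i + 2 \<in> ?side i" using side[of "i + 2"] by simp
      moreover have "i + 1 \<notin> ?side i" using differ side[of "i + 1"] S(1) by (auto split: if_splits)
      then have "x \<notin> ?side i" if "i < x" "x < i + 2" for x
        using that by (cases "x = i + 1") auto
      ultimately show ?thesis using side[of i] by (intro pair[of i "?side i" "i + 2"]) auto
    qed
  qed
  then show "F \<inter> {i..i + 2} \<noteq> {}" "((S \<union> T) - F) \<inter> {i..i + 2} \<noteq> {}" by blast+
qed

lemma subseqs_sums:
  assumes "distinct xs" "t \<in> set (map (\<lambda>ys. \<Sum>i\<leftarrow>ys. int i) (subseqs xs))"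
  shows "\<exists>X\<subseteq>set xs. (\<Sum>i\<in>X. int i) = t"
proof -
  obtain ys where ys: "ys \<in> set (subseqs xs)" "t = (\<Sum>i\<leftarrow>ys. int i)" using assms(2) by auto
  then have "distinct ys" using subseqs_distinctD assms(1) by blast
  moreover have "set ys \<subseteq> set xs" using ys(1) subseqs_powset[of xs] by blast
  ultimately show ?thesis
    using ys(2) by (intro exI[of _ "set ys"]) (simp add: sum_list_distinct_conv_sum_set)
qed

text \<open>The combinatorial core. Think of \<open>B\<close> as the coins whose coefficient is odd: its half
  must be rounded up in at least one of two copies, while an even coefficient may be rounded up in at most one
  of them; \<open>D\<close> and \<open>E\<close> collect the coins that are rounded up. The two sum conditions
  become independent by cutting the coins into \<open>Fd\<close> and \<open>Fe\<close>: on \<open>Fd\<close> the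
  set \<open>E\<close> is fixed to be \<open>B\<close>, so that \<open>D\<close> may be any subset there, and on
  \<open>Fe\<close> the roles are exchanged. Each condition is then a subset sum problem of its own. The sets
  \<open>{1, 2, 4, 8}\<close> and \<open>{3, 5, 6, 7}\<close> start the two families of subset sums, with all of
  \<open>[0, 15]\<close> and of \<open>[5, 16]\<close>; the larger coins are dealt out alternately, separately
  inside and outside \<open>B\<close>, which places the targets well inside the reachable intervals. For
  \<open>E\<close> the margin 25 is needed in full: the small coins contribute up to 15 to the imbalance, and 5
  is lost at both ends. For \<open>D\<close> the small coins contribute up to 21, but nothing is lost.\<close>

lemma halving_sets:
  fixes B :: "nat set" and \<alpha> \<beta> :: int
  defines "\<sigma> \<equiv> \<lambda>X. \<Sum>i\<in>X. int i"
  assumes B: "B \<subseteq> {1..n}" and n: "8 \<le> n"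
    and \<alpha>: "int n + 25 \<le> 2 * \<alpha> - \<sigma> B" "2 * \<alpha> - \<sigma> B \<le> \<sigma> {1..n} - int n - 25"
    and \<beta>: "int n + 25 \<le> 2 * \<beta> - \<sigma> B" "2 * \<beta> - \<sigma> B \<le> \<sigma> {1..n} - int n - 25"
  shows "\<exists>D E. D \<subseteq> {1..n} \<and> E \<subseteq> {1..n} \<and> \<sigma> D = \<alpha> \<and> \<sigma> E = \<beta> \<and> D \<inter> E \<subseteq> B \<and> B \<subseteq> D \<union> E"
proof -
  define A where "A = {1..n} - B"
  define R where "R = alternate (B \<inter> {9..n}) \<union> alternate (A \<inter> {9..n})"
  define Fd where "Fd = {1, 2, 4, 8} \<union> R"
  define Fe where "Fe = {1..n} - Fd"
  have alt: "alternate (P \<inter> {9..n}) \<subseteq> P \<inter> {9..n}" for P by (rule alternate_subset)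
  have R: "R \<subseteq> {9..n}" using alt[of A] alt[of B] unfolding R_def by blast
  then have R': "x \<in> R \<Longrightarrow> 9 \<le> x \<and> x \<le> n" for x by auto
  have up_to_8: "{1..8::nat} = {1, 2, 3, 4, 5, 6, 7, 8}"
    unfolding set_eq_iff atLeastAtMost_iff insert_iff empty_iff by presburger
  have Fd_sub: "Fd \<subseteq> {1..n}" using n unfolding Fd_def by (auto dest: R')
  have R8: "R \<inter> {1..8} = {}" by (auto dest: R')
  have small_d: "Fd \<inter> {1..8} = {1, 2, 4, 8}"
    unfolding Fd_def Int_Un_distrib2 R8 unfolding up_to_8 by auto
  have "Fe \<inter> {1..8} = {1..8} - Fd \<inter> {1..8}" using n by (auto simp: Fe_def)
  also have "\<dots> = {3, 5, 6, 7}" unfolding small_d unfolding up_to_8 by (simp add: insert_Diff_if)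
  finally have small_e: "Fe \<inter> {1..8} = {3, 5, 6, 7}" .
  have \<sigma>_Un: "\<sigma> (X \<union> Y) = \<sigma> X + \<sigma> Y" if "X \<inter> Y = {}" "X \<subseteq> {1..n}" "Y \<subseteq> {1..n}" for X Y
    unfolding \<sigma>_def using that finite_subset[of _ "{1..n}"] by (intro sum.union_disjoint) auto
  have \<sigma>_mono: "0 \<le> \<sigma> X \<and> \<sigma> X \<le> \<sigma> Y" if "X \<subseteq> Y" "finite Y" for X Y
    unfolding \<sigma>_def using that by (auto intro: sum_mono2 sum_nonneg)
  have even_split: "\<sigma> (P \<inter> Fe) \<le> \<sigma> (P \<inter> Fd) + int n + 21 \<and> \<sigma> (P \<inter> Fd) \<le> \<sigma> (P \<inter> Fe) + int n + 15"
    if P: "P = A \<or> P = B" for P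
  proof -
    let ?H = "P \<inter> {9..n}"
    have sub: "P \<subseteq> {1..n}" using P B A_def by auto
    have "A \<inter> B = {}" by (auto simp: A_def)
    then have PR: "P \<inter> R = alternate ?H"
      using P alt[of A] alt[of B] unfolding R_def by blast
    have d: "P \<inter> Fd = (P \<inter> {1, 2, 4, 8}) \<union> alternate ?H"
      unfolding Fd_def Int_Un_distrib PR ..
    have "P = (P \<inter> {1..8}) \<union> ?H" using sub by fastforce
    then have "P \<inter> Fe = (P \<inter> (Fe \<inter> {1..8})) \<union> (?H \<inter> Fe)" by blast
    moreover have "?H \<inter> Fe = ?H - alternate ?H"
    proof -
      have "x \<notin> {1, 2, 4, 8}" if "x \<in> ?H" for x using that by auto
      then show ?thesis unfolding Fe_def Fd_def PR[symmetric] by auto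
    qed
    ultimately have e: "P \<inter> Fe = (P \<inter> {3, 5, 6, 7}) \<union> (?H - alternate ?H)"
      unfolding small_e by simp
    have low_high: "\<sigma> (X \<union> Y) = \<sigma> X + \<sigma> Y" if "X \<subseteq> {1..8}" "Y \<subseteq> {9..n}" for X Y
    proof (rule \<sigma>_Un)
      have "{1..8} \<inter> {9..n} = {}" by auto
      then show "X \<inter> Y = {}" using that by blast
      have "{1..8} \<subseteq> {1..n}" "{9..n} \<subseteq> {1..n}" using n by auto
      then show "X \<subseteq> {1..n}" "Y \<subseteq> {1..n}" using that by blast+
    qed
    have low: "P \<inter> {1, 2, 4, 8} \<subseteq> {1..8}" "P \<inter> {3, 5, 6, 7} \<subseteq> {1..8}" unfolding up_to_8 by auto
    have high: "alternate ?H \<subseteq> {9..n}" "?H - alternate ?H \<subseteq> {9..n}" using alt[of P] by auto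
    have "\<sigma> (P \<inter> Fd) = \<sigma> (P \<inter> {1, 2, 4, 8}) + \<sigma> (alternate ?H)"
      unfolding d by (rule low_high[OF low(1) high(1)])
    moreover have "\<sigma> (P \<inter> Fe) = \<sigma> (P \<inter> {3, 5, 6, 7}) + \<sigma> (?H - alternate ?H)"
      unfolding e by (rule low_high[OF low(2) high(2)])
    moreover have "\<bar>\<sigma> (alternate ?H) - \<sigma> (?H - alternate ?H)\<bar> \<le> int n"
      unfolding \<sigma>_def by (rule alternate_sum_diff) auto
    moreover have "0 \<le> \<sigma> (P \<inter> {1, 2, 4, 8}) \<and> \<sigma> (P \<inter> {1, 2, 4, 8}) \<le> \<sigma> {1, 2, 4, 8}"
      "0 \<le> \<sigma> (P \<inter> {3, 5, 6, 7}) \<and> \<sigma> (P \<inter> {3, 5, 6, 7}) \<le> \<sigma> {3, 5, 6, 7}" by (rule \<sigma>_mono; simp)+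
    moreover have "\<sigma> {1, 2, 4, 8} = 15" "\<sigma> {3, 5, 6, 7} = 21" by (simp_all add: \<sigma>_def)
    ultimately show ?thesis by linarith
  qed
  have window: "Fd \<inter> {i..i + 2} \<noteq> {}" "Fe \<inter> {i..i + 2} \<noteq> {}" if "9 \<le> i" "i + 2 \<le> n" for i
  proof -
    have split: "B \<inter> {9..n} \<inter> (A \<inter> {9..n}) = {}" "{i, i + 1, i + 2} \<subseteq> B \<inter> {9..n} \<union> A \<inter> {9..n}"
      using that by (auto simp: A_def)
    from alternate_window(1)[OF split] show "Fd \<inter> {i..i + 2} \<noteq> {}" unfolding Fd_def R_def by blast
    have "(B \<inter> {9..n} \<union> A \<inter> {9..n}) - R \<subseteq> Fe"
      using B by (auto simp: Fe_def Fd_def A_def)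
    then show "Fe \<inter> {i..i + 2} \<noteq> {}" using alternate_window(2)[OF split] unfolding R_def by blast
  qed
  have whole: "F \<inter> {1..n} = F" if "F \<subseteq> {1..n}" for F :: "nat set" using that by auto
  have sums_d: "\<exists>X\<subseteq>Fd. \<sigma> X = t" if "0 \<le> t" "t \<le> \<sigma> Fd" for t
  proof -
    have "\<exists>X\<subseteq>{1, 2, 4, 8}. \<sigma> X = t" if "0 \<le> t" "t \<le> 15" for t
    proof -
      have "t \<in> set (map (\<lambda>ys. \<Sum>i\<leftarrow>ys. int i) (subseqs [1, 2, 4, 8]))"
        using that by (simp add: Let_def) presburger
      from subseqs_sums[OF _ this] show ?thesis unfolding \<sigma>_def by simp
    qed
    then have "\<exists>X\<subseteq>Fd \<inter> {1..n}. (\<Sum>i\<in>X. int i) = t"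
      using n that window(1) whole[of Fd] Fd_sub
      by (intro subset_sums_fill_interval[of 0 Fd n n t], unfold small_d) (simp_all add: \<sigma>_def)
    then show ?thesis unfolding \<sigma>_def by blast
  qed
  have sums_e: "\<exists>X\<subseteq>Fe. \<sigma> X = t" if "5 \<le> t" "t \<le> \<sigma> Fe - 5" for t
  proof -
    have "\<exists>X\<subseteq>{3, 5, 6, 7}. \<sigma> X = t" if "5 \<le> t" "t \<le> 16" for t
    proof -
      have "t \<in> set (map (\<lambda>ys. \<Sum>i\<leftarrow>ys. int i) (subseqs [3, 5, 6, 7]))"
        using that by (simp add: Let_def) presburger
      from subseqs_sums[OF _ this] show ?thesis unfolding \<sigma>_def by simp
    qed
    moreover have "Fe \<subseteq> {1..n}" by (auto simp: Fe_def)
    ultimately have "\<exists>X\<subseteq>Fe \<inter> {1..n}. (\<Sum>i\<in>X. int i) = t"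
      using n that window(2) whole[of Fe] 
      by (intro subset_sums_fill_interval[of 5 Fe n n t], unfold small_e) (simp_all add: \<sigma>_def)
    then show ?thesis unfolding \<sigma>_def by blast
  qed
  have parts: "\<sigma> B = \<sigma> (B \<inter> Fd) + \<sigma> (B \<inter> Fe)" "\<sigma> Fd = \<sigma> (B \<inter> Fd) + \<sigma> (A \<inter> Fd)" "\<sigma> Fe = \<sigma> (B \<inter> Fe) + \<sigma> (A \<inter> Fe)"
    "\<sigma> {1..n} = \<sigma> Fd + \<sigma> Fe"
  proof -
    have "B = (B \<inter> Fd) \<union> (B \<inter> Fe)" "Fd = (B \<inter> Fd) \<union> (A \<inter> Fd)" "Fe = (B \<inter> Fe) \<union> (A \<inter> Fe)" "{1..n} = Fd \<union> Fe"
      using B Fd_sub by (auto simp: A_def Fe_def)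
    then show "\<sigma> B = \<sigma> (B \<inter> Fd) + \<sigma> (B \<inter> Fe)" "\<sigma> Fd = \<sigma> (B \<inter> Fd) + \<sigma> (A \<inter> Fd)"
      "\<sigma> Fe = \<sigma> (B \<inter> Fe) + \<sigma> (A \<inter> Fe)" "\<sigma> {1..n} = \<sigma> Fd + \<sigma> Fe"
      using B Fd_sub \<sigma>_Un[of "B \<inter> Fd" "B \<inter> Fe"] \<sigma>_Un[of "B \<inter> Fd" "A \<inter> Fd"] \<sigma>_Un[of "B \<inter> Fe" "A \<inter> Fe"] \<sigma>_Un[of Fd Fe]
      by (auto simp: A_def Fe_def)
  qed
  have bal: "\<sigma> (B \<inter> Fe) \<le> \<sigma> (B \<inter> Fd) + int n + 21" "\<sigma> (B \<inter> Fd) \<le> \<sigma> (B \<inter> Fe) + int n + 15"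
    "\<sigma> (A \<inter> Fe) \<le> \<sigma> (A \<inter> Fd) + int n + 21" "\<sigma> (A \<inter> Fd) \<le> \<sigma> (A \<inter> Fe) + int n + 15"
    using even_split by auto
  obtain X where X: "X \<subseteq> Fd" "\<sigma> X = \<alpha> - \<sigma> (B \<inter> Fe)"
    using sums_d[of "\<alpha> - \<sigma> (B \<inter> Fe)"] \<alpha> parts bal by (auto simp: algebra_simps)
  obtain Y where Y: "Y \<subseteq> Fe" "\<sigma> Y = \<beta> - \<sigma> (B \<inter> Fd)"
    using sums_e[of "\<beta> - \<sigma> (B \<inter> Fd)"] \<beta> parts bal by (auto simp: algebra_simps)
  have "\<sigma> ((B \<inter> Fe) \<union> X) = \<alpha>" "\<sigma> ((B \<inter> Fd) \<union> Y) = \<beta>"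
    using X Y B Fd_sub \<sigma>_Un[of "B \<inter> Fe" X] \<sigma>_Un[of "B \<inter> Fd" Y] by (auto simp: Fe_def)
  moreover have "((B \<inter> Fe) \<union> X) \<inter> ((B \<inter> Fd) \<union> Y) \<subseteq> B" "B \<subseteq> ((B \<inter> Fe) \<union> X) \<union> ((B \<inter> Fd) \<union> Y)"
    "(B \<inter> Fe) \<union> X \<subseteq> {1..n}" "(B \<inter> Fd) \<union> Y \<subseteq> {1..n}"
    using X Y B Fd_sub by (auto simp: Fe_def)
  ultimately show ?thesis by blast
qed

section \<open>Rounding halves without changing moments\<close>

text \<open>The vector form of the preceding lemma: \<open>v / 2\<close> is rounded twice, with prescribed
  moments, such that the two roundings add up to \<open>v\<close> or \<open>v + 1\<close> in each entry. As
  \<open>s + t\<close> lies between the moments of \<open>v\<close> and \<open>v + 1\<close>, the natural range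
  for \<open>2 * s\<close> and \<open>2 * t\<close> is the same interval; the hypotheses keep them away from its
  ends.\<close>

lemma halving_rounding:
  fixes v :: "nat \<Rightarrow> int" and s t :: int
  assumes n: "8 \<le> n"
    and s: "int n + 25 \<le> 2 * s - moment n v" "2 * s - moment n v \<le> (\<Sum>i\<in>{1..n}. int i) - int n - 25"
    and t: "int n + 25 \<le> 2 * t - moment n v" "2 * t - moment n v \<le> (\<Sum>i\<in>{1..n}. int i) - int n - 25"
  obtains d e where "moment n d = s" "moment n e = t"
    "\<And>i. i \<in> {1..n} \<Longrightarrow> d i \<in> {v i div 2, v i div 2 + 1}"
    "\<And>i. i \<in> {1..n} \<Longrightarrow> e i \<in> {v i div 2, v i div 2 + 1}"
    "\<And>i. i \<in> {1..n} \<Longrightarrow> d i + e i \<in> {v i, v i + 1}"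
proof -
  define u where "u i = v i div 2" for i
  define B where "B = {i\<in>{1..n}. odd (v i)}"
  have add_indicator: "moment n (\<lambda>i. u i + (if i \<in> X then 1 else 0)) = moment n u + (\<Sum>i\<in>X. int i)"
    if "X \<subseteq> {1..n}" for X
  proof -
    have "(\<Sum>i\<in>{1..n}. (if i \<in> X then 1 else 0) * int i) = (\<Sum>i\<in>{1..n}. if i \<in> X then int i else 0)"
      by (rule sum.cong) auto
    also have "\<dots> = (\<Sum>i\<in>X. int i)"
      using that by (simp add: sum.inter_restrict[symmetric] Int_absorb1)
    finally show ?thesis by (simp add: moment_def distrib_right sum.distrib)
  qed
  have B: "B \<subseteq> {1..n}" by (auto simp: B_def)
  have v: "v i = 2 * u i + (if i \<in> B then 1 else 0)" if "i \<in> {1..n}" for i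
    using that by (auto simp: u_def B_def elim: oddE)
  have "moment n v = (\<Sum>i\<in>{1..n}. u i * int i + (u i + (if i \<in> B then 1 else 0)) * int i)"
    unfolding moment_def by (rule sum.cong) (auto simp: v algebra_simps)
  also have "\<dots> = moment n u + moment n (\<lambda>i. u i + (if i \<in> B then 1 else 0))"
    unfolding moment_def by (rule sum.distrib)
  finally have mv: "moment n v = 2 * moment n u + (\<Sum>i\<in>B. int i)"
    using add_indicator[OF B] by simp
  have "\<exists>D E. D \<subseteq> {1..n} \<and> E \<subseteq> {1..n} \<and> (\<Sum>i\<in>D. int i) = s - moment n u \<and> (\<Sum>i\<in>E. int i) = t - moment n u \<and>
      D \<inter> E \<subseteq> B \<and> B \<subseteq> D \<union> E"
    using s t mv by (intro halving_sets n B) auto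
  then obtain D E where DE: "D \<subseteq> {1..n}" "E \<subseteq> {1..n}" "(\<Sum>i\<in>D. int i) = s - moment n u"
      "(\<Sum>i\<in>E. int i) = t - moment n u" "D \<inter> E \<subseteq> B" "B \<subseteq> D \<union> E"
    by blast
  show ?thesis
  proof (rule that)
    show "moment n (\<lambda>i. u i + (if i \<in> D then 1 else 0)) = s" "moment n (\<lambda>i. u i + (if i \<in> E then 1 else 0)) = t"
      using add_indicator DE by auto
    show "u i + (if i \<in> D then 1 else 0) + (u i + (if i \<in> E then 1 else 0)) \<in> {v i, v i + 1}" if "i \<in> {1..n}" for i
      using DE(5,6) v[OF that] by auto
  qed (auto simp: u_def)
qed

section \<open>Dyadic rounding of the balanced linear function\<close>

lemma two_sum: "2 * (\<Sum>i\<in>{1..n}. int i) = int n * (int n + 1)"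
  by (induction n) (auto simp: algebra_simps)

lemma six_sum_squares: "6 * (\<Sum>i\<in>{1..n}. int i * int i) = int n * (int n + 1) * (2 * int n + 1)"
  by (induction n) (auto simp: algebra_simps)

text \<open>Up to a factor this is the only balanced linear function of the weight. Its values lie strictly
  between \<open>- 2 n\<close> and \<open>2 n\<close>, and half of it decreases by \<open>3/2\<close> from coin
  to coin.\<close>

definition tilt :: "nat \<Rightarrow> nat \<Rightarrow> int" where
  "tilt n i = 2 * int n + 1 - 3 * int i"

lemma moment_tilt: "moment n (tilt n) = 0"
proof -
  have "moment n (tilt n) = (2 * int n + 1) * (\<Sum>i\<in>{1..n}. int i) - 3 * (\<Sum>i\<in>{1..n}. int i * int i)"
    by (simp add: moment_def tilt_def sum_distrib_left sum_subtractf algebra_simps sum.distrib)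
  then have "2 * moment n (tilt n) = (2 * int n + 1) * (2 * (\<Sum>i\<in>{1..n}. int i)) - 6 * (\<Sum>i\<in>{1..n}. int i * int i)"
    by (simp only:) (simp add: algebra_simps)
  then show ?thesis unfolding two_sum six_sum_squares by (simp add: algebra_simps)
qed

text \<open>Each pair \<open>(i, i + s)\<close> contributes at least \<open>s * i\<close>. For small
  \<open>s\<close> all pairs are used, each coin being counted at most twice. For \<open>s\<close> between
  \<open>n/4\<close> and \<open>n/2\<close> this loses too much, and the disjoint pairs formed by the
  \<open>2 s\<close> heaviest coins are used instead.\<close>

lemma paired_mass:
  fixes g :: "nat \<Rightarrow> int"
  assumes n: "32 \<le> n" and s: "1 \<le> s" "2 * s < n"
    and nonneg: "\<And>i. 0 \<le> g i"
    and pair: "\<And>i. int s \<le> g i \<or> int s \<le> g (i + s)"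
  shows "2 * int s * (int n + 25) \<le> (\<Sum>i\<in>{1..n}. g i * int i)"
proof -
  let ?M = "\<Sum>i\<in>{1..n}. g i * int i"
  have shift: "int s * (\<Sum>i\<in>{a+1..b}. int i) \<le> (\<Sum>i\<in>{a+1..b}. g i * int i) + (\<Sum>i\<in>{a+1+s..b+s}. g i * int i)" for a b
  proof -
    have "int s * int i \<le> g i * int i + g (i + s) * int (i + s)" for i
    proof -
      have "int s * int i \<le> g i * int i \<or> int s * int i \<le> g (i + s) * int (i + s)"
        using pair[of i] nonneg by (auto intro: mult_mono mult_right_mono)
      moreover have "0 \<le> g i * int i" "0 \<le> g (i + s) * int (i + s)" using nonneg by auto
      ultimately show ?thesis by linarith
    qed
    then have "(\<Sum>i\<in>{a+1..b}. int s * int i) \<le> (\<Sum>i\<in>{a+1..b}. g i * int i + g (i + s) * int (i + s))"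
      by (rule sum_mono)
    also have "\<dots> = (\<Sum>i\<in>{a+1..b}. g i * int i) + (\<Sum>i\<in>{a+1+s..b+s}. g i * int i)"
      unfolding sum.shift_bounds_cl_nat_ivl by (simp add: sum.distrib)
    finally show ?thesis by (simp add: sum_distrib_left)
  qed
  have part: "(\<Sum>i\<in>I. g i * int i) \<le> ?M" if "I \<subseteq> {1..n}" for I
    using that nonneg by (intro sum_mono2) auto
  show ?thesis
  proof (cases "4 * s \<le> n")
    case True
    define k where "k = n - s"
    have k0: "int k = int n - int s" using s unfolding k_def by auto
    moreover have "4 * int s \<le> int n" using True by linarith
    ultimately have k: "4 * int k \<ge> 3 * int n" by linarith
    have "k + s = n" using s unfolding k_def by auto
    then have "int s * (\<Sum>i\<in>{1..k}. int i) \<le> 2 * ?M"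
      using shift[of 0 k] part[of "{1..k}"] part[of "{1+s..k+s}"] by auto
    then have "int s * (2 * (\<Sum>i\<in>{1..k}. int i)) \<le> 4 * ?M" by linarith
    then have M: "int s * (int k * (int k + 1)) \<le> 4 * ?M" unfolding two_sum .
    have "(3 * int n) * (3 * int n + 4) \<le> (4 * int k) * (4 * int k + 4)"
      by (rule mult_mono) (use k in linarith)+
    moreover have "96 * (3 * int n + 4) \<le> (3 * int n) * (3 * int n + 4)"
      using n by (intro mult_right_mono) auto
    ultimately have "8 * (int n + 25) \<le> int k * (int k + 1)" using n by (simp add: algebra_simps)
    then have "int s * (8 * (int n + 25)) \<le> int s * (int k * (int k + 1))" by (intro mult_left_mono) auto
    then show ?thesis using M by (simp add: algebra_simps)
  next
    case False
    define a where "a = n - 2 * s"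
    have a: "int a = int n - 2 * int s" "a + s = n - s" "a + s + s = n" using s unfolding a_def by auto
    have sets: "{a+1..a+s} \<inter> {a+1+s..a+s+s} = {}" "{a+1..a+s} \<union> {a+1+s..a+s+s} \<subseteq> {1..n}" using a by auto
    have "int s * (\<Sum>i\<in>{a+1..a+s}. int i) \<le> (\<Sum>i\<in>{a+1..a+s} \<union> {a+1+s..a+s+s}. g i * int i)"
      using shift[of a "a+s"] sets by (subst sum.union_disjoint) auto
    also have "\<dots> \<le> ?M" by (rule part[OF sets(2)])
    finally have "int s * (2 * (\<Sum>i\<in>{a+1..a+s}. int i)) \<le> 2 * ?M" by linarith
    moreover have "2 * (\<Sum>i\<in>{a+1..a+s}. int i) = int s * (2 * int a + int s + 1)"
      by (induction s) (auto simp: algebra_simps)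
    moreover have "2 * int a + int s + 1 = 2 * int n - 3 * int s + 1" using a by simp
    ultimately have M: "int s * (int s * (2 * int n - 3 * int s + 1)) \<le> 2 * ?M" by (simp only:)
    \<comment> \<open>The quadratic function of \<open>s\<close> in \<open>M\<close> is concave, so it is bounded below by its values at \<open>n/4\<close> and \<open>(n - 1)/2\<close>.\<close>
    have "0 \<le> (4 * int s - int n) * (int n - 1 - 2 * int s)" using False s by (intro mult_nonneg_nonneg) auto
    also have "\<dots> = 6 * (int s * int n) - 4 * int s - 8 * (int s * int s) - int n * int n + int n"
      by (simp add: algebra_simps)
    finally have f1: "8 * (int s * int s) \<le> 6 * (int s * int n) - 4 * int s - int n * int n + int n" by linarith
    have "0 \<le> (int n - 10) * (int n - 2 * int s)" using n s by (intro mult_nonneg_nonneg) auto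
    also have "\<dots> = int n * int n - 2 * (int s * int n) - 10 * int n + 20 * int s" by (simp add: algebra_simps)
    finally have f2: "2 * (int s * int n) + 10 * int n \<le> int n * int n + 20 * int s" by linarith
    have f3: "32 * int n \<le> int n * int n" using n by (intro mult_right_mono) auto
    have "int s * (2 * int n - 3 * int s + 1) = 2 * (int s * int n) - 3 * (int s * int s) + int s"
      by (simp add: algebra_simps)
    moreover have "4 * (int n + 25) \<le> 2 * (int s * int n) - 3 * (int s * int s) + int s"
    proof -
      have "4 * (b + 25) \<le> 2 * y - 3 * x + a"
        if "8 * x \<le> 6 * y - 4 * a - z + b" "2 * y + 10 * b \<le> z + 20 * a" "32 * b \<le> z" "32 \<le> b" for a b x y z :: int
        using that by (smt (verit))
      from this[OF f1 f2 f3] show ?thesis using n by simp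
    qed
    ultimately have "4 * (int n + 25) \<le> int s * (2 * int n - 3 * int s + 1)" by simp
    then have "int s * (4 * (int n + 25)) \<le> int s * (int s * (2 * int n - 3 * int s + 1))" by (intro mult_left_mono) auto
    then show ?thesis using M by (simp add: algebra_simps)
  qed
qed

text \<open>Since \<open>tilt\<close> is balanced, \<open>2 s V\<close> is the moment of the residues modulo
  \<open>2 s\<close>. As \<open>tilt\<close> drops by \<open>3 s\<close> between \<open>i\<close> and
  \<open>i + s\<close>, which is \<open>s\<close> modulo \<open>2 s\<close>, one of these two coins has a
  residue of at least \<open>s\<close> and the other one a residue below \<open>s\<close>. Hence both the
  residues and their complements have a large moment.\<close>

lemma rounding_slack_fine:
  assumes n: "32 \<le> n" and s: "1 \<le> s" "2 * s < n"
  defines "V \<equiv> - moment n (\<lambda>i. tilt n i div (2 * int s))"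
  shows "int n + 25 \<le> V" "V \<le> (\<Sum>i\<in>{1..n}. int i) - int n - 25"
proof -
  let ?N = "2 * int s"
  define r where "r i = tilt n i mod ?N" for i
  have r: "0 \<le> r i" "r i < ?N" for i using s by (auto simp: r_def)
  have pair: "r i < int s \<longleftrightarrow> int s \<le> r (i + s)" for i
  proof -
    have "tilt n (i + s) = (tilt n i + int s) + ?N * (-2)"
      unfolding tilt_def by (simp add: algebra_simps)
    then have "r (i + s) = (tilt n i + int s) mod ?N"
      unfolding r_def by (simp only: mod_mult_self2)
    also have "\<dots> = (r i + int s) mod ?N"
      unfolding r_def by (simp only: mod_add_left_eq)
    also have "\<dots> = (if r i < int s then r i + int s else r i - int s)"
    proof (cases "r i < int s")
      case False
      have "(r i + int s) mod ?N = (r i - int s + ?N) mod ?N" by (simp add: algebra_simps)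
      also have "\<dots> = r i - int s" using r[of i] False by (simp only: mod_add_self2 mod_pos_pos_trivial)
      finally show ?thesis using False by simp
    qed (use r[of i] in auto)
    finally show ?thesis using r[of i] by auto
  qed
  have "?N * V + moment n (tilt n) = (\<Sum>i\<in>{1..n}. r i * int i)"
  proof -
    have "(\<Sum>i\<in>{1..n}. r i * int i) = (\<Sum>i\<in>{1..n}. tilt n i * int i - ?N * (tilt n i div ?N * int i))"
      by (rule sum.cong) (auto simp: r_def minus_mult_div_eq_mod[symmetric] algebra_simps)
    then show ?thesis by (simp add: V_def moment_def sum_subtractf sum_distrib_left)
  qed
  then have NV: "?N * V = (\<Sum>i\<in>{1..n}. r i * int i)" by (simp add: moment_tilt)
  have "?N * (int n + 25) \<le> (\<Sum>i\<in>{1..n}. r i * int i)"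
  proof (rule paired_mass[OF n s])
    show "0 \<le> r i" for i using r[of i] by simp
    show "int s \<le> r i \<or> int s \<le> r (i + s)" for i using pair[of i] by linarith
  qed
  then have "?N * (int n + 25) \<le> ?N * V" unfolding NV .
  then show "int n + 25 \<le> V" using s mult_le_cancel_left_pos[of ?N "int n + 25" V] by linarith
  have "?N * (int n + 25) \<le> (\<Sum>i\<in>{1..n}. (?N - r i) * int i)"
  proof (rule paired_mass[OF n s])
    show "0 \<le> ?N - r i" for i using r[of i] by simp
    show "int s \<le> ?N - r i \<or> int s \<le> ?N - r (i + s)" for i using pair[of i] r[of i] by linarith
  qed
  also have "\<dots> = ?N * (\<Sum>i\<in>{1..n}. int i) - ?N * V"
    unfolding NV by (simp add: left_diff_distrib sum_subtractf sum_distrib_left)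
  finally have "?N * (int n + 25) \<le> ?N * ((\<Sum>i\<in>{1..n}. int i) - V)" by (simp add: right_diff_distrib)
  then show "V \<le> (\<Sum>i\<in>{1..n}. int i) - int n - 25" using s mult_le_cancel_left_pos[of ?N "int n + 25" "(\<Sum>i\<in>{1..n}. int i) - V"] by linarith
qed

text \<open>For a modulus \<open>N\<close> of about the size of the range of \<open>tilt\<close> the quotients
  are known explicitly: they are \<open>-1\<close> on the heaviest third of the coins, and positive, namely 1,
  at most on the lightest third.\<close>

lemma rounding_slack_coarse:
  assumes n: "32 \<le> n" and N: "int n \<le> N" "N < 2 * int n"
  defines "V \<equiv> - moment n (\<lambda>i. tilt n i div N)"
  shows "int n + 25 \<le> V" "V \<le> (\<Sum>i\<in>{1..n}. int i) - int n - 25"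
proof -
  define p where "p = (2 * n + 1) div 3"
  define r where "r = (n + 1) div 3"
  let ?T = "\<lambda>k. \<Sum>i\<in>{1..k}. int i"
  let ?q = "\<lambda>i. tilt n i div N"
  have q_low: "?q i = -1" if "i \<in> {1..n}" "p < i" for i
  proof -
    have "- N \<le> tilt n i" "tilt n i < 0" using that N n by (auto simp: p_def tilt_def)
    then show ?thesis using N n by (intro int_div_pos_eq[of _ _ _ "tilt n i + N"]) auto
  qed
  have q_high: "0 \<le> ?q i" "?q i \<le> (if i \<le> r then 1 else 0)" if "i \<in> {1..n}" "i \<le> p" for i
  proof -
    have z: "0 \<le> tilt n i" "tilt n i < 2 * N" using that N n by (auto simp: p_def tilt_def)
    then show "0 \<le> ?q i" using N n by (simp add: pos_imp_zdiv_nonneg_iff)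
    show "?q i \<le> (if i \<le> r then 1 else 0)"
    proof (cases "i \<le> r")
      case True
      have "N * ?q i \<le> tilt n i" using N n by (simp add: minus_mod_eq_mult_div[symmetric])
      then have "N * ?q i < N * 2" using z by linarith
      then have "?q i < 2" using N n mult_less_cancel_left_pos[of N "?q i" 2] by linarith
      then show ?thesis using True by simp
    next
      case False
      then have "tilt n i < N" using N n by (auto simp: r_def tilt_def)
      then show ?thesis using False z by simp
    qed
  qed
  have p: "p \<le> n" and r: "r \<le> p" using n by (auto simp: p_def r_def)
  have split: "(\<Sum>i\<in>{1..n}. f i) = (\<Sum>i\<in>{1..p}. f i) + (\<Sum>i\<in>{p+1..n}. f i)" for f :: "nat \<Rightarrow> int"
    using p sum.ub_add_nat[of 1 p f "n - p"] by simp
  have top: "(\<Sum>i\<in>{p+1..n}. ?q i * int i) = - (?T n - ?T p)"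
  proof -
    have "(\<Sum>i\<in>{p+1..n}. ?q i * int i) = (\<Sum>i\<in>{p+1..n}. - int i)"
      using q_low by (intro sum.cong) auto
    then show ?thesis using split[of int] by (simp add: sum_negf)
  qed
  have "(\<Sum>i\<in>{1..p}. ?q i * int i) \<le> (\<Sum>i\<in>{1..p}. if i \<in> {1..r} then int i else 0)"
  proof (rule sum_mono)
    fix i assume i: "i \<in> {1..p}"
    then have "?q i \<le> (if i \<le> r then 1 else 0)" using q_high(2)[of i] p by simp
    then have "?q i * int i \<le> (if i \<le> r then 1 else 0) * int i" by (rule mult_right_mono) simp
    also have "(if i \<le> r then 1 else 0) * int i = (if i \<in> {1..r} then int i else 0)" using i by auto
    finally show "?q i * int i \<le> (if i \<in> {1..r} then int i else 0)" .
  qed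
  also have "\<dots> = (\<Sum>i\<in>{1..p} \<inter> {1..r}. int i)" by (simp only: sum.inter_restrict finite_atLeastAtMost)
  also have "{1..p} \<inter> {1..r} = {1..r}" using r by auto
  finally have low: "(\<Sum>i\<in>{1..p}. ?q i * int i) \<le> ?T r" .
  have "0 \<le> (\<Sum>i\<in>{1..p}. ?q i * int i)"
    using q_high(1) p by (intro sum_nonneg mult_nonneg_nonneg) auto
  then have V: "?T n - ?T p - ?T r \<le> V" "V \<le> ?T n - ?T p"
    using low top split[of "\<lambda>i. ?q i * int i"] by (auto simp: V_def moment_def)
  have p3: "3 * int p \<le> 2 * int n + 1" "2 * int n - 1 \<le> 3 * int p" and r3: "3 * int r \<le> int n + 1"
    by (auto simp: p_def r_def)
  have n2: "32 * int n \<le> int n * int n" using n by (intro mult_right_mono) auto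
  have nine: "(3 * x) * (3 * x + 3) = 9 * (x * (x + 1))" for x :: int by (simp add: algebra_simps)
  have "(3 * int p) * (3 * int p + 3) \<le> (2 * int n + 1) * (2 * int n + 1 + 3)"
    by (rule mult_mono) (use p3 in linarith)+
  then have p_up: "18 * ?T p \<le> 4 * (int n * int n) + 10 * int n + 4"
    unfolding nine two_sum[symmetric] by (simp add: algebra_simps)
  have "(3 * int r) * (3 * int r + 3) \<le> (int n + 1) * (int n + 1 + 3)"
    by (rule mult_mono) (use r3 in linarith)+
  then have r_up: "18 * ?T r \<le> int n * int n + 5 * int n + 4"
    unfolding nine two_sum[symmetric] by (simp add: algebra_simps)
  have T: "2 * ?T n = int n * int n + int n" using two_sum[of n] by (simp add: algebra_simps)
  have "b + 25 \<le> t - u - v" if "2 * t = z + b" "18 * u \<le> 4 * z + 10 * b + 4" "18 * v \<le> z + 5 * b + 4"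
      "32 * b \<le> z" "32 \<le> b" for b t u v z :: int
    using that by (smt (verit))
  from this[OF T p_up r_up n2] have "int n + 25 \<le> ?T n - ?T p - ?T r" using n by simp
  then show "int n + 25 \<le> V" using V by linarith
  have "(2 * int n - 1) * (2 * int n - 1 + 3) \<le> (3 * int p) * (3 * int p + 3)"
    by (rule mult_mono) (use p3 n in linarith)+
  then have p_low: "4 * (int n * int n) + 2 * int n - 2 \<le> 18 * ?T p"
    unfolding nine two_sum[symmetric] by (simp add: algebra_simps)
  have "b + 25 \<le> u" if "4 * z + 2 * b - 2 \<le> 18 * u" "32 * b \<le> z" "32 \<le> b" for b u z :: int
    using that by linarith
  from this[OF p_low n2] have "int n + 25 \<le> ?T p" using n by simp
  then show "V \<le> ?T n - int n - 25" using V by linarith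
qed

section \<open>The finest level: strict monotonicity\<close>

lemma sum_odd_even_split:
  fixes f :: "nat \<Rightarrow> int"
  shows "(\<Sum>i\<in>{1..n}. f i) = (\<Sum>i\<in>{i\<in>{1..n}. odd i}. f i) + (\<Sum>k\<in>{1..n div 2}. f (2 * k))"
proof -
  have "(\<Sum>i\<in>{1..n}. f i) = (\<Sum>i\<in>{i\<in>{1..n}. odd i}. f i) + (\<Sum>i\<in>{i\<in>{1..n}. even i}. f i)"
    by (subst sum.union_disjoint[symmetric]) (auto intro: sum.cong)
  also have "{i\<in>{1..n}. even i} = (*) 2 ` {1..n div 2}"
    by (auto elim!: evenE)
  also have "(\<Sum>i\<in>(*) 2 ` {1..n div 2}. f i) = (\<Sum>k\<in>{1..n div 2}. f (2 * k))"
    by (subst sum.reindex) (auto intro: inj_onI)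
  finally show ?thesis .
qed

text \<open>At the last doubling the sum \<open>d + e\<close> must be strictly decreasing. It rounds
  \<open>tilt / 2\<close>, which is an integer at odd \<open>i\<close> and a half-integer at even
  \<open>i\<close>, with steps of \<open>3/2\<close>. If the odd coins are not rounded at all, then either
  choice at the even coins preserves strict monotonicity; coin 1 may be rounded up as well, because no coin
  precedes it. The even coins \<open>2 k\<close> are treated by the halving lemma for the coins
  \<open>k\<close>, which can compensate any even moment of moderate size left by the odd coins. Odd entries
  \<open>x i\<close> at odd coins are shared between \<open>d\<close> and \<open>e\<close> alternately; coin 1
  and one further coin \<open>p\<close> adjust the parities of the two moments.\<close>

lemma finest_rounding:
  assumes n: "32 \<le> n"
  obtains d e where "moment n d = 0" "moment n e = 0"
    "\<And>i. i \<in> {1..n} \<Longrightarrow> d i \<in> {tilt n i div 4, tilt n i div 4 + 1}"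
    "\<And>i. i \<in> {1..n} \<Longrightarrow> e i \<in> {tilt n i div 4, tilt n i div 4 + 1}"
    "\<And>i. 1 \<le> i \<Longrightarrow> i < n \<Longrightarrow> d (Suc i) + e (Suc i) < d i + e i"
proof -
  define h where "h = n div 2"
  define u where "u i = tilt n i div 4" for i
  define x where "x i = tilt n i div 2" for i
  define Od where "Od = {i\<in>{1..n}. odd i}"
  \<comment> \<open>A light coin with odd \<open>x p\<close>.\<close>
  define p where "p = (if odd n then 3 else 5 :: nat)"
  define H where "H = {i\<in>Od. 3 \<le> i \<and> odd (x i)} - {p}"
  define H1 where "H1 = alternate H"
  define H2 where "H2 = H - H1"
  let ?\<sigma> = "\<lambda>X. \<Sum>i\<in>X. int i"
  define U where "U = (\<Sum>i\<in>Od. u i * int i)"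
  have fin: "finite Od" "finite H" "finite H1" "finite H2"
    by (auto simp: Od_def H_def H1_def H2_def alternate_def)
  have x: "2 * x i = tilt n i" if "odd i" for i
    using that by (auto simp: x_def tilt_def)
  have u: "u i = x i div 2" for i
    by (simp add: u_def x_def zdiv_zmult2_eq[symmetric])
  have p: "p \<in> Od" "3 \<le> p" "p \<le> 5" "odd (x p)" "odd p"
  proof -
    show "odd p" "3 \<le> p" "p \<le> 5" by (auto simp: p_def)
    then show "p \<in> Od" using n by (auto simp: Od_def)
    have "2 * x p = 2 * int n + 1 - 3 * int p" using x[OF \<open>odd p\<close>] by (simp add: tilt_def)
    then have "x p = (if odd n then int n - 4 else int n - 7)" by (auto simp: p_def)
    then show "odd (x p)" by simp
  qed
  \<comment> \<open>The coin \<open>p\<close> goes to \<open>D\<close> if \<open>b\<close> holds and to \<open>E\<close> otherwise. Then \<open>b1\<close> and \<open>b2\<close>, the presence of coin 1 in \<open>D\<close> and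
    \<open>E\<close>, are forced by parity, and \<open>b\<close> is chosen such that they suit the parity of \<open>x 1\<close>.\<close>
  define b where "b \<longleftrightarrow> (if even (x 1) then odd (U + ?\<sigma> H1) else odd (U + ?\<sigma> H2))"
  define b1 where "b1 \<longleftrightarrow> odd (U + ?\<sigma> H1) \<noteq> b"
  define b2 where "b2 \<longleftrightarrow> odd (U + ?\<sigma> H2) = b"
  define D where "D = H1 \<union> ((if b then {p} else {}) \<union> (if b1 then {1} else {}))"
  define E where "E = H2 \<union> ((if b then {} else {p}) \<union> (if b2 then {1} else {}))"
  have H_sub: "H \<subseteq> Od" "p \<notin> H" "1 \<notin> H" "H1 \<subseteq> H" "H2 \<subseteq> H" "H1 \<inter> H2 = {}" "H1 \<union> H2 = H"
    using alternate_subset[of H] by (auto simp: H_def H1_def H2_def)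
  have "1 \<in> Od" using n by (auto simp: Od_def)
  have DE_sub: "D \<subseteq> Od" "E \<subseteq> Od" using H_sub p \<open>1 \<in> Od\<close> by (auto simp: D_def E_def)
  have sum_D: "?\<sigma> D = ?\<sigma> H1 + (if b then int p else 0) + (if b1 then 1 else 0)"
    and sum_E: "?\<sigma> E = ?\<sigma> H2 + (if b then 0 else int p) + (if b2 then 1 else 0)"
    using H_sub p fin unfolding D_def E_def by (auto simp: sum.union_disjoint)
  have even_D: "even (U + ?\<sigma> D)" and even_E: "even (U + ?\<sigma> E)"
    unfolding sum_D sum_E using p(5) by (auto simp: b1_def b2_def)
  have count: "(if i \<in> D then 1 else 0) + (if i \<in> E then 1 else 0) = x i - 2 * u i" if "i \<in> Od" "i \<noteq> 1" for i
  proof -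
    have "i \<in> H \<longleftrightarrow> odd (x i) \<and> i \<noteq> p" using that by (auto simp: H_def Od_def elim!: oddE)
    moreover have "i \<in> D \<longleftrightarrow> i \<in> H1 \<or> (i = p \<and> b)" "i \<in> E \<longleftrightarrow> i \<in> H2 \<or> (i = p \<and> \<not> b)"
      using that by (auto simp: D_def E_def)
    ultimately have "(if i \<in> D then 1 else 0) + (if i \<in> E then 1 else 0) = (if odd (x i) then 1 else 0 :: int)"
      using H_sub p(4) by auto
    also have "\<dots> = x i - 2 * u i" unfolding u by (auto elim!: oddE)
    finally show ?thesis .
  qed
  have count1: "(if 1 \<in> D then 1 else 0) + (if 1 \<in> E then 1 else 0) \<in> {x 1 - 2 * u 1, x 1 - 2 * u 1 + 1}"
  proof -
    have "1 \<in> D \<longleftrightarrow> b1" "1 \<in> E \<longleftrightarrow> b2" using H_sub p by (auto simp: D_def E_def)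
    moreover have "x 1 - 2 * u 1 = (if odd (x 1) then 1 else 0)" unfolding u by (auto elim!: oddE)
    moreover have "even (x 1) \<Longrightarrow> \<not> b1" "odd (x 1) \<Longrightarrow> b2" by (auto simp: b_def b1_def b2_def)
    ultimately show ?thesis by auto
  qed
  define dodd where "dodd i = u i + (if i \<in> D then 1 else 0)" for i
  define eodd where "eodd i = u i + (if i \<in> E then 1 else 0)" for i
  have indicator: "(\<Sum>i\<in>Od. (u i + (if i \<in> X then 1 else 0)) * int i) = U + ?\<sigma> X" if "X \<subseteq> Od" for X
  proof -
    have "(\<Sum>i\<in>Od. (u i + (if i \<in> X then 1 else 0)) * int i) = (\<Sum>i\<in>Od. u i * int i + (if i \<in> X then int i else 0))"
      by (rule sum.cong) (auto simp: algebra_simps)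
    also have "\<dots> = U + (\<Sum>i\<in>Od \<inter> X. int i)"
      by (simp add: U_def sum.distrib sum.inter_restrict fin)
    finally show ?thesis using that by (simp add: Int_absorb1)
  qed
  have sum_d: "(\<Sum>i\<in>Od. dodd i * int i) = U + ?\<sigma> D" and sum_e: "(\<Sum>i\<in>Od. eodd i * int i) = U + ?\<sigma> E"
    unfolding dodd_def eodd_def using indicator DE_sub by auto
  \<comment> \<open>The amount by which coin 1 is rounded up.\<close>
  define bump where "bump = dodd 1 + eodd 1 - x 1"
  have bump: "bump \<in> {0, 1}" using count1 by (auto simp: bump_def dodd_def eodd_def)
  have "(\<Sum>i\<in>Od. dodd i * int i) + (\<Sum>i\<in>Od. eodd i * int i) = (\<Sum>i\<in>Od. x i * int i + (if i = 1 then bump else 0))"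
    unfolding sum.distrib[symmetric]
  proof (rule sum.cong)
    fix i assume "i \<in> Od"
    then show "dodd i * int i + eodd i * int i = x i * int i + (if i = 1 then bump else 0)"
      using count[of i] unfolding distrib_right[symmetric]
      by (cases "i = 1") (auto simp: bump_def dodd_def eodd_def)
  qed simp
  also have "\<dots> = (\<Sum>i\<in>Od. x i * int i) + bump" using \<open>1 \<in> Od\<close> fin by (simp add: sum.distrib)
  finally have total: "(U + ?\<sigma> D) + (U + ?\<sigma> E) = (\<Sum>i\<in>Od. x i * int i) + bump" unfolding sum_d sum_e .
  let ?v = "\<lambda>k. int n - 3 * int k"
  let ?T = "\<Sum>k\<in>{1..h}. int k"
  have tilt_even: "tilt n (2 * k) = 2 * ?v k + 1" for k by (simp add: tilt_def)
  have "0 = (\<Sum>i\<in>Od. tilt n i * int i) + (\<Sum>k\<in>{1..h}. tilt n (2 * k) * int (2 * k))"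
    using moment_tilt[of n] sum_odd_even_split[of "\<lambda>i. tilt n i * int i" n] by (simp add: moment_def Od_def h_def)
  also have "(\<Sum>i\<in>Od. tilt n i * int i) = 2 * (\<Sum>i\<in>Od. x i * int i)"
    unfolding sum_distrib_left by (rule sum.cong) (auto simp: Od_def x[symmetric])
  also have "(\<Sum>k\<in>{1..h}. tilt n (2 * k) * int (2 * k)) = 4 * moment h ?v + 2 * ?T"
    unfolding tilt_even moment_def sum_distrib_left sum.distrib[symmetric]
    by (rule sum.cong) (auto simp: algebra_simps)
  finally have balance: "(\<Sum>i\<in>Od. x i * int i) = - 2 * moment h ?v - ?T" by linarith
  have near: "\<bar>?\<sigma> D - ?\<sigma> E\<bar> \<le> int n + 6"
  proof -
    have "\<bar>?\<sigma> H1 - ?\<sigma> H2\<bar> \<le> int n"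
      unfolding H1_def H2_def using H_sub(1) by (intro alternate_sum_diff) (auto simp: Od_def)
    then show ?thesis unfolding sum_D sum_E using p(3) by auto
  qed
  have h: "16 \<le> h" "int n \<le> 2 * int h + 1" using n by (auto simp: h_def)
  have T: "4 * int h + 58 \<le> ?T"
  proof -
    have "16 * (int h + 1) \<le> int h * (int h + 1)" using h by (intro mult_right_mono) auto
    then have "16 * (int h + 1) \<le> 2 * ?T" unfolding two_sum .
    then show ?thesis using h by simp
  qed
  obtain s t where s: "U + ?\<sigma> D = - 2 * s" and t: "U + ?\<sigma> E = - 2 * t"
    using even_D even_E by (metis evenE minus_mult_minus minus_minus)
  have st: "2 * (2 * s - moment h ?v) = ?T - bump - (?\<sigma> D - ?\<sigma> E)" "2 * (2 * t - moment h ?v) = ?T - bump + (?\<sigma> D - ?\<sigma> E)"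
    using s t total balance by algebra+
  have range: "int h + 25 \<le> 2 * s - moment h ?v" "2 * s - moment h ?v \<le> ?T - int h - 25"
     "int h + 25 \<le> 2 * t - moment h ?v" "2 * t - moment h ?v \<le> ?T - int h - 25"
    using st near bump T h by auto
  obtain dev eev where dev: "moment h dev = s" "moment h eev = t"
    "\<And>k. k \<in> {1..h} \<Longrightarrow> dev k \<in> {?v k div 2, ?v k div 2 + 1}"
    "\<And>k. k \<in> {1..h} \<Longrightarrow> eev k \<in> {?v k div 2, ?v k div 2 + 1}"
    "\<And>k. k \<in> {1..h} \<Longrightarrow> dev k + eev k \<in> {?v k, ?v k + 1}"
    using halving_rounding[of h s ?v t] range h(1) by auto
  define d where "d i = (if even i then dev (i div 2) else dodd i)" for i
  define e where "e i = (if even i then eev (i div 2) else eodd i)" for i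
  have merge: "moment n (\<lambda>i. if even i then f (i div 2) else g i) = (\<Sum>i\<in>Od. g i * int i) + 2 * moment h f" for f g
    unfolding moment_def sum_odd_even_split[of _ n] h_def[symmetric] Od_def[symmetric]
    by (auto simp: Od_def sum_distrib_left algebra_simps intro!: arg_cong2[of _ _ _ _ "(+)"] sum.cong)
  have quarter: "tilt n i div 4 = ?v (i div 2) div 2" if "even i" for i
    using that by (auto simp: tilt_def elim!: evenE)
  have half: "i div 2 \<in> {1..h}" if "i \<in> {1..n}" "even i" for i
    using that by (auto simp: h_def elim!: evenE)
  have c_even: "2 * (d i + e i) \<in> {2 * int n - 3 * int i, 2 * int n - 3 * int i + 2}" if "i \<in> {1..n}" "even i" for i
    using dev(5)[OF half[OF that]] that(2) by (auto simp: d_def e_def elim!: evenE)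
  have c_odd: "d i + e i = x i" if "i \<in> Od" "i \<noteq> 1" for i
    using count[OF that] that by (auto simp: d_def e_def dodd_def eodd_def Od_def)
  have c_1: "x 1 \<le> d 1 + e 1" using bump by (auto simp: d_def e_def bump_def)
  show ?thesis
  proof (rule that[of d e])
    show "moment n d = 0" "moment n e = 0"
      unfolding d_def e_def merge sum_d sum_e using dev s t by simp_all
    show "d i \<in> {tilt n i div 4, tilt n i div 4 + 1}" if "i \<in> {1..n}" for i
      using dev(3)[OF half[OF that]] quarter by (cases "even i") (auto simp: d_def dodd_def u_def)
    show "e i \<in> {tilt n i div 4, tilt n i div 4 + 1}" if "i \<in> {1..n}" for i
      using dev(4)[OF half[OF that]] quarter by (cases "even i") (auto simp: e_def eodd_def u_def)
    show "d (Suc i) + e (Suc i) < d i + e i" if i: "1 \<le> i" "i < n" for i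
    proof (cases "even i")
      case True
      then have "Suc i \<in> Od" "Suc i \<noteq> 1" using i by (auto simp: Od_def)
      then have "2 * (d (Suc i) + e (Suc i)) = 2 * int n + 1 - 3 * int (Suc i)"
        using c_odd[of "Suc i"] x[of "Suc i"] True by (simp add: tilt_def)
      then show ?thesis using c_even[of i] True i by auto
    next
      case False
      have "x i \<le> d i + e i" using c_1 c_odd[of i] i False by (cases "i = 1") (auto simp: Od_def)
      moreover have "2 * x i = 2 * int n + 1 - 3 * int i" using x[OF False] by (simp add: tilt_def)
      moreover have "2 * (d (Suc i) + e (Suc i)) \<le> 2 * int n - 3 * int (Suc i) + 2"
        using c_even[of "Suc i"] False i by auto
      ultimately show ?thesis by simp
    qed
  qed
qed

section \<open>Descending through the binary levels\<close>

text \<open>Starting from the zero vector, which rounds \<open>tilt / 2 ^ (m + 1)\<close> because of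
  \<open>\<bar>tilt\<bar> < 2 ^ (m + 1)\<close>, each doubling of the resolution costs two weighings. The
  doublings stop one level before the finest one.\<close>

lemma coarse_rounding_certifiable:
  assumes n: "32 \<le> n" and m: "n \<le> 2 ^ m" "2 ^ m < 2 * n" and "k < m"
  shows "\<exists>c. certifiable n (2 * k) c \<and> moment n c = 0 \<and>
     (\<forall>i\<in>{1..n}. c i \<in> {tilt n i div 2 ^ (m - k + 1), tilt n i div 2 ^ (m - k + 1) + 1})"
  using \<open>k < m\<close>
proof (induction k)
  case 0
  have "0 \<in> {tilt n i div 2 ^ (m + 1), tilt n i div 2 ^ (m + 1) + 1}" if i: "i \<in> {1..n}" for i
  proof -
    let ?N = "2 ^ (m + 1) :: int"
    have "int n \<le> 2 ^ m" using m(1) by (metis of_nat_le_iff of_nat_numeral of_nat_power)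
    then have z: "tilt n i < ?N" "- ?N \<le> tilt n i"
      using i unfolding tilt_def power_add power_one_right atLeastAtMost_iff by linarith+
    show ?thesis
    proof (cases "0 \<le> tilt n i")
      case True
      then show ?thesis using z by simp
    next
      case False
      then have "tilt n i div ?N = -1" using z by (intro int_div_pos_eq[of _ _ _ "tilt n i + ?N"]) auto
      then show ?thesis by simp
    qed
  qed
  then show ?case using certifiable_zero by (intro exI[of _ "\<lambda>_. 0"]) (simp add: moment_def)
next
  case (Suc k)
  define j where "j = m - k"
  have j: "2 \<le> j" "j \<le> m" "m - Suc k + 1 = j" "m - k + 1 = j + 1" using Suc.prems by (auto simp: j_def)
  define v where "v i = tilt n i div 2 ^ j" for i
  obtain c where c: "certifiable n (2 * k) c" "moment n c = 0"
    "\<And>i. i \<in> {1..n} \<Longrightarrow> c i \<in> {tilt n i div 2 ^ (j + 1), tilt n i div 2 ^ (j + 1) + 1}"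
    using Suc j(4) by auto
  have vj: "v i div 2 = tilt n i div 2 ^ (j + 1)" for i
    by (simp add: v_def zdiv_zmult2_eq[symmetric] mult.commute)
  have slack: "int n + 25 \<le> - moment n v" "- moment n v \<le> (\<Sum>i\<in>{1..n}. int i) - int n - 25"
  proof -
    have "int n + 25 \<le> - moment n v \<and> - moment n v \<le> (\<Sum>i\<in>{1..n}. int i) - int n - 25"
    proof (cases "j = m")
      case True
      have "int n \<le> int (2 ^ m)" "int (2 ^ m) < int (2 * n)" using m by (simp_all only: of_nat_le_iff of_nat_less_iff)
      then have N: "int n \<le> 2 ^ m" "2 ^ m < 2 * int n" by simp_all
      show ?thesis using rounding_slack_coarse[OF n N] unfolding v_def True by blast
    next
      case False
      define s where "s = (2 :: nat) ^ (j - 1)"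
      have "2 * (2 * s) = 2 ^ (j + 1)" using j(1) by (cases j) (auto simp: s_def)
      also have "\<dots> \<le> (2 :: nat) ^ m" using j False by (intro power_increasing) auto
      finally have "1 \<le> s" "2 * s < n" using m(2) by (auto simp: s_def)
      moreover have "2 * int s = 2 ^ j" using j(1) by (cases j) (auto simp: s_def)
      ultimately show ?thesis using rounding_slack_fine[OF n, of s] unfolding v_def by simp
    qed
    then show "int n + 25 \<le> - moment n v" "- moment n v \<le> (\<Sum>i\<in>{1..n}. int i) - int n - 25" by auto
  qed
  obtain d e where de: "moment n d = 0" "moment n e = 0"
    "\<And>i. i \<in> {1..n} \<Longrightarrow> d i \<in> {v i div 2, v i div 2 + 1}"
    "\<And>i. i \<in> {1..n} \<Longrightarrow> e i \<in> {v i div 2, v i div 2 + 1}"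
    "\<And>i. i \<in> {1..n} \<Longrightarrow> d i + e i \<in> {v i, v i + 1}"
    using halving_rounding[of n 0 v 0] n slack by auto
  have "certifiable n (Suc (Suc (2 * k))) (\<lambda>i. d i + e i)"
    using de(3,4) unfolding vj by (intro certifiable_refine[OF c de(1) _ de(2)])
  then show ?case
    unfolding j(3) using de by (intro exI[of _ "\<lambda>i. d i + e i"]) (simp add: moment_add v_def)
qed

lemma identify_large:
  assumes n: "32 \<le> n" and m: "n \<le> 2 ^ m" "2 ^ m < 2 * n"
  shows "\<exists>Ws. length Ws = 2 * m \<and> (\<forall>W\<in>set Ws. is_weighing n W) \<and> identifies_all n Ws"
proof -
  have m1: "m \<ge> 1" using n m(1) by (cases m) auto
  then have "m - (m - 1) + 1 = 2" by simp
  then obtain c where c: "certifiable n (2 * (m - 1)) c" "moment n c = 0"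
    "\<And>i. i \<in> {1..n} \<Longrightarrow> c i \<in> {tilt n i div 4, tilt n i div 4 + 1}"
    using coarse_rounding_certifiable[OF n m, of "m - 1"] m1 by auto
  obtain d e where de: "moment n d = 0" "moment n e = 0"
    "\<And>i. i \<in> {1..n} \<Longrightarrow> d i \<in> {tilt n i div 4, tilt n i div 4 + 1}"
    "\<And>i. i \<in> {1..n} \<Longrightarrow> e i \<in> {tilt n i div 4, tilt n i div 4 + 1}"
    "\<And>i. 1 \<le> i \<Longrightarrow> i < n \<Longrightarrow> d (Suc i) + e (Suc i) < d i + e i"
    using finest_rounding[OF n] by blast
  have "certifiable n (Suc (Suc (2 * (m - 1)))) (\<lambda>i. d i + e i)"
    by (rule certifiable_refine[OF c de(1,3,2,4)])
  moreover have "Suc (Suc (2 * (m - 1))) = 2 * m" using m1 by simp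
  ultimately show ?thesis using certifiable_decreasing_identifies[of n "2 * m" "\<lambda>i. d i + e i"] de(5) by simp
qed

section \<open>Fewer than 32 coins\<close>

text \<open>Small coins leave too little room for the general argument. Here four weighings suffice from three
  coins on. A row of the table lists for each coin a number whose four ternary digits, lowered by 1, give its
  place in the four weighings. The multipliers 7, 13, 25, 47 grow by a factor of about 2 rather than 3, so that
  the first differences are not governed by a single weighing; with powers of 3 the leading nonzero weighing
  would itself have to be a decreasing step function with signed sum 0 or \<open>-1\<close>, which need not
  exist (for five coins it does not).\<close>

definition trit :: "nat \<Rightarrow> nat \<Rightarrow> int" where
  "trit j a = int (a div 3 ^ j mod 3) - 1"

definition small_value :: "nat \<Rightarrow> int" where
  "small_value a = 7 * trit 0 a + 13 * trit 1 a + 25 * trit 2 a + 47 * trit 3 a"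

definition valid_row :: "nat list \<Rightarrow> bool" where
  "valid_row as \<longleftrightarrow>
     (\<forall>j\<in>{0, 1, 2, 3}. (\<Sum>(i, a)\<leftarrow>zip [1..<Suc (length as)] as. trit j a * int i) \<in> {-1, 0}) \<and>
     sorted_wrt (\<lambda>x y. y < x) (map small_value as)"

definition small_table :: "nat list list" where
  "small_table =
  [[62, 63, 13],
   [49, 42, 45, 32],
   [66, 48, 57, 43, 11],
   [62, 65, 59, 47, 42, 12],
   [71, 65, 50, 58, 40, 31, 21],
   [79, 70, 53, 59, 40, 37, 24, 28],
   [77, 49, 56, 57, 46, 41, 39, 25, 31],
   [80, 75, 66, 64, 44, 46, 38, 39, 31, 16],
   [79, 74, 67, 53, 60, 43, 46, 38, 39, 31, 13],
   [80, 79, 71, 69, 67, 60, 49, 47, 37, 23, 28, 6],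
   [70, 73, 72, 66, 51, 47, 48, 43, 41, 33, 22, 31, 29],
   [74, 67, 62, 65, 50, 47, 48, 56, 57, 45, 34, 32, 21, 16],
   [77, 70, 72, 52, 59, 49, 58, 44, 48, 55, 41, 40, 24, 28, 13],
   [74, 70, 73, 62, 64, 63, 44, 48, 43, 54, 40, 38, 39, 32, 17, 21],
   [80, 79, 77, 73, 72, 65, 52, 51, 44, 42, 45, 54, 35, 38, 31, 19, 7],
   [80, 78, 76, 71, 74, 68, 62, 61, 50, 49, 42, 45, 54, 33, 21, 29, 16, 11],
   [76, 74, 75, 68, 72, 67, 53, 50, 58, 47, 57, 46, 55, 40, 33, 36, 17, 21, 8],
   [79, 76, 71, 75, 70, 68, 72, 65, 64, 51, 60, 44, 54, 40, 25, 17, 29, 30, 19, 13],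
   [76, 68, 67, 53, 62, 65, 66, 51, 59, 60, 49, 43, 55, 41, 45, 25, 34, 37, 22, 28, 13],
   [80, 78, 76, 75, 70, 73, 68, 67, 66, 50, 44, 43, 46, 55, 45, 40, 26, 33, 31, 28, 18, 8],
   [80, 79, 77, 74, 75, 73, 53, 52, 64, 59, 60, 49, 44, 48, 57, 43, 46, 39, 34, 36, 19, 8, 2],
   [80, 78, 76, 75, 70, 73, 68, 67, 65, 66, 59, 63, 49, 58, 48, 56, 41, 40, 25, 34, 24, 15, 10, 2],
   [78, 71, 75, 73, 72, 67, 53, 62, 66, 61, 64, 51, 63, 58, 44, 40, 26, 38, 32, 36, 22, 31, 30, 16, 19],
   [77, 78, 71, 75, 73, 68, 69, 72, 53, 62, 66, 52, 61, 64, 51, 56, 57, 43, 35, 37, 22, 20, 30, 19, 12,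
    5],
   [80, 79, 78, 74, 68, 72, 65, 61, 50, 51, 59, 60, 63, 58, 44, 56, 55, 41, 42, 40, 25, 37, 24, 17, 21,
    27, 11],
   [80, 79, 76, 71, 74, 75, 70, 73, 68, 69, 72, 66, 51, 59, 63, 44, 48, 56, 46, 41, 34, 23, 36, 17, 16,
    27, 11, 6],
   [80, 78, 76, 74, 70, 73, 72, 62, 65, 50, 59, 63, 58, 44, 48, 46, 55, 41, 42, 45, 26, 39, 25, 32, 33,
    21, 29, 16, 28],
   [79, 76, 74, 75, 70, 73, 68, 72, 67, 65, 52, 61, 50, 51, 59, 63, 49, 58, 48, 56, 46, 41, 35, 25, 33,
    21, 16, 28, 5, 9],
   [80, 79, 78, 71, 74, 75, 70, 68, 69, 67, 53, 62, 65, 61, 50, 58, 47, 48, 46, 54, 40, 26, 24, 32, 33,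
    22, 31, 21, 29, 27, 13]]"

lemma small_table_valid: "list_all valid_row small_table" "map length small_table = [3..<32]"
  by code_simp+

lemma identify_small:
  assumes "3 \<le> n" "n < 32"
  shows "\<exists>Ws. length Ws = 4 \<and> (\<forall>W\<in>set Ws. is_weighing n W) \<and> identifies_all n Ws"
proof -
  have "n \<in> set (map length small_table)" unfolding small_table_valid(2) set_upt using assms by simp
  then obtain as where as: "as \<in> set small_table" "length as = n" by auto
  then have valid: "valid_row as" using small_table_valid(1) by (simp add: list_all_iff)
  define f where "f j i = trit j (as ! (i - 1))" for j i
  have f01: "f j i \<in> {-1, 0, 1}" for j i
  proof -
    have "as ! (i - 1) div 3 ^ j mod 3 < 3" by simp
    then show ?thesis by (auto simp: f_def trit_def)
  qed
  have moment_f: "moment n (f j) \<in> {-1, 0}" if "j \<in> {0, 1, 2, 3}" for j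
  proof -
    have "(\<Sum>(i, a)\<leftarrow>zip [1..<Suc n] as. trit j a * int i) = (\<Sum>k<n. trit j (as ! k) * int (Suc k))"
      unfolding sum_list_sum_nth using as(2) by (auto intro!: sum.cong simp: atLeast0LessThan simp del: upt_Suc)
    also have "\<dots> = moment n (f j)"
      unfolding moment_def f_def by (rule sum.reindex_bij_witness[of _ "\<lambda>i. i - 1" Suc]) auto
    finally show ?thesis using valid that as(2) by (auto simp: valid_row_def)
  qed
  have "certifiable n (Suc (Suc (Suc (Suc 0)))) (\<lambda>i. 1 * (1 * (1 * (1 * 0 + 7 * f 0 i) + 13 * f 1 i) + 25 * f 2 i) + 47 * f 3 i)"
    using f01 moment_f by (intro certifiable_Suc certifiable_zero) auto
  moreover have "Suc (Suc (Suc (Suc 0))) = 4" by simp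
  ultimately have "certifiable n 4 (\<lambda>i. small_value (as ! (i - 1)))"
    by (simp only: small_value_def f_def mult_1 mult_zero_right add_0)
  then show ?thesis
  proof (rule certifiable_decreasing_identifies)
    fix i assume i: "1 \<le> i" "i < n"
    then show "small_value (as ! (Suc i - 1)) < small_value (as ! (i - 1))"
      using valid as(2) by (auto simp: valid_row_def sorted_wrt_iff_nth_less)
  qed
qed

lemma identify_two: "\<exists>Ws. length Ws = 1 \<and> (\<forall>W\<in>set Ws. is_weighing 2 W) \<and> identifies_all 2 Ws"
proof -
  have "moment 2 (\<lambda>i. if i = 1 then 1 else -1) = -1"
    by (simp add: moment_def numeral_2_eq_2)
  then have "certifiable 2 (Suc 0) (\<lambda>i. 1 * 0 + 1 * (if i = 1 then 1 else -1))"
    by (intro certifiable_Suc certifiable_zero) auto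
  then have "\<exists>Ws. length Ws = Suc 0 \<and> (\<forall>W\<in>set Ws. is_weighing 2 W) \<and> identifies_all 2 Ws"
    by (rule certifiable_decreasing_identifies) auto
  then show ?thesis by simp
qed

section \<open>The bound for every number of coins\<close>

lemma identify_within_bound:
  fixes n :: nat
  assumes "n \<ge> 1"
  shows "\<exists>Ws. (\<forall>W\<in>set Ws. is_weighing n W) \<and> identifies_all n Ws \<and>
               int (length Ws) \<le> 2 * \<lceil>log 2 (real n)\<rceil>"
proof -
  define m where "m = nat \<lceil>log 2 (real n)\<rceil>"
  have "0 \<le> log 2 (real n)" using assms by simp
  then have m: "int m = \<lceil>log 2 (real n)\<rceil>" by (simp add: m_def)
  have "log 2 (real n) \<le> real m" using m by linarith
  then have up: "n \<le> 2 ^ m"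
    using assms by (simp add: log_le_iff powr_realpow)
  have "real m - 1 < log 2 (real n)" using m by linarith
  then have "2 powr (real m - 1) < real n" using assms by (simp add: less_log_iff)
  then have "real (2 ^ m) < real (2 * n)" by (simp add: powr_diff powr_realpow)
  then have low: "2 ^ m < 2 * n" by (simp only: of_nat_less_iff)
  have "\<exists>Ws. (\<forall>W\<in>set Ws. is_weighing n W) \<and> identifies_all n Ws \<and> length Ws \<le> 2 * m"
  proof -
    consider "n = 1" | "n = 2" | "3 \<le> n" "n < 32" | "32 \<le> n" using assms by linarith
    then show ?thesis
    proof cases
      case 1
      have "identifies_all 1 []"
        by (auto simp: identifies_all_def identifies_def permutes_sing)
      then show ?thesis using 1 by (intro exI[of _ "[]"]) simp
    next
      case 2
      have "m \<noteq> 0" using up 2 by (cases m) auto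
      then show ?thesis using identify_two 2 by fastforce
    next
      case 3
      have "2 \<le> m"
      proof (rule ccontr)
        assume "\<not> 2 \<le> m"
        then have "(2::nat) ^ m \<le> 2 ^ 1" by (intro power_increasing) auto
        then show False using up 3 by simp
      qed
      then show ?thesis using identify_small[OF 3] by fastforce
    next
      case 4
      then show ?thesis using identify_large[OF 4 up low] by fastforce
    qed
  qed
  then show ?thesis using m by (metis of_nat_le_iff of_nat_mult of_nat_numeral)
qed

theorem theorem2:
  fixes n :: nat
  assumes "n \<ge> 1"
  shows "(\<exists>Ws. (\<forall>W\<in>set Ws. is_weighing n W) \<and> identifies_all n Ws \<and>
               int (length Ws) \<le> 2 * \<lceil>log 2 (real n)\<rceil>) \<and>
         int (min_weighings n) \<le> 2 * \<lceil>log 2 (real n)\<rceil>"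
proof -
  obtain Ws where Ws: "\<forall>W\<in>set Ws. is_weighing n W" "identifies_all n Ws"
      "int (length Ws) \<le> 2 * \<lceil>log 2 (real n)\<rceil>"
    using identify_within_bound[OF assms] by blast
  then have "min_weighings n \<le> length Ws"
    unfolding min_weighings_def by (intro Least_le) blast
  then show ?thesis using Ws by force
qed

end
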